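(* Let $I_G\subseteq\mathbb{K}[E(G)]$ be the toric ideal of a finite simple graph $G$. Assume that $I_G$ has a universal Gröbner basis consisting entirely of quadratic binomials. Then $I_G$ is geometrically vertex decomposable.
   Context: $\mathbb{K}$ is an algebraically closed field of characteristic zero. A universal Gröbner basis of an ideal is a set that is a Gröbner basis with respect to every monomial order. Toric ideal of a graph. For a finite simple graph $G$ with vertices $V(G)=\{x_1,\ldots,x_n\}$ and edges $E(G)=\{e_1,\ldots,e_t\}$, let $\mathbb{K}[E(G)]=\mathbb{K}[e_1,\ldots,e_t]$ and $\mathbb{K}[V(G)]=\mathbb{K}[x_1,\ldots,x_n]$ be polynomial rings. The toric ideal $I_G\subseteq\mathbb{K}[E(G)]$ is the kernel of the $\mathbb{K}$-algebra homomorphism $\varphi_G:\mathbb{K}[E(G)]\to\mathbb{K}[V(G)]$, $\varphi_G(e_i)=x_jx_k$ where $e_i=\{x_j,x_k\}$. Geometric vertex decomposability. Let $R=\mathbb{K}[x_1,\ldots,x_n]$ be a polynomial ring and fix a variable $y=x_i$. Write $0\neq f\in R$ as $f=\sum_j\alpha_jy^j$ with $\alpha_j$ not involving $y$; if $d$ is the largest index with $\alpha_d\neq0$, put $\mathrm{in}_y(f)=\alpha_dy^d$. For an ideal $I$, $\mathrm{in}_y(I)=\langle \mathrm{in}_y(f)\mid f\in I\rangle$. A monomial order $<$ is $y$-compatible if $\mathrm{in}_<(f)=\mathrm{in}_<(\mathrm{in}_y(f))$ for all $f$. Given a $y$-compatible order $<$ and a Gröbner basis $\{g_1,\ldots,g_m\}$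 of $I$ with respect to $<$, write $g_j=y^{d_j}q_j+r_j$ with $\mathrm{in}_y(g_j)=y^{d_j}q_j$ and $y$ dividing no term of $q_j$, and set $C_{y,I}=\langle q_1,\ldots,q_m\rangle$ and $N_{y,I}=\langle q_j\mid d_j=0\rangle$. An ideal $I$ is unmixed if $\dim(R/I)=\dim(R/P)$ for all $P\in\mathrm{Ass}_R(R/I)$. The ideal $I$ is geometrically vertex decomposable if $I$ is unmixed and either (1) $I=\langle1\rangle$ or $I$ is generated by a (possibly empty) subset of the variables of $R$; or (2) there are a variable $y=x_i$ and a $y$-compatible monomial order $<$ such that $\mathrm{in}_y(I)=C_{y,I}\cap(N_{y,I}+\langle y\rangle)$ and the contractions of $C_{y,I}$ and $N_{y,I}$ to $\mathbb{K}[x_1,\ldots,\hat{x}_i,\ldots,x_n]$ are geometrically vertex decomposable. By convention the ideals $\langle0\rangle$ and $\langle1\rangle$ of the ring $\mathbb{K}$ are geometrically vertex decomposable. *)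

theory Defs
  imports
    "HOL-Library.Poly_Mapping"
    "HOL-Library.Extended_Nat"
    "HOL-Computational_Algebra.Polynomial"
    "HOL-Algebra.QuotRing"
begin

section \<open>Polynomial rings over a set of variables\<close>

text \<open>
  Monomials are finitely supported exponent vectors; a polynomial is a finitely supported function
  from monomials to coefficients. The product of monomials is addition of exponent vectors and the
  monomial 1 is \<^term>\<open>0\<close>. The ring \<open>K[X]\<close> consists of those polynomials
  in which only variables from \<open>X\<close> occur, so dropping a variable keeps the type.
\<close>

type_synonym 'x mono = "'x \<Rightarrow>\<^sub>0 nat"
type_synonym ('x, 'k) mpoly = "('x \<Rightarrow>\<^sub>0 nat) \<Rightarrow>\<^sub>0 'k"

definition monomials :: "'x set \<Rightarrow> 'x mono set" where
  "monomials X = {m. Poly_Mapping.keys m \<subseteq> X}"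

definition poly_ring :: "'x set \<Rightarrow> ('x, 'k::field) mpoly ring" where
  "poly_ring X =
    \<lparr>carrier = {p. Poly_Mapping.keys p \<subseteq> monomials X}, mult = (*), one = 1, zero = 0, add = (+)\<rparr>"

definition var :: "'x \<Rightarrow> ('x, 'k::field) mpoly" where
  "var x = Poly_Mapping.single (Poly_Mapping.single x 1) 1"

definition total_degree :: "('x, 'k::field) mpoly \<Rightarrow> nat" where
  "total_degree p = Max (insert 0
     ((\<lambda>m. \<Sum>x\<in>Poly_Mapping.keys m. Poly_Mapping.lookup m x) ` Poly_Mapping.keys p))"

definition quadratic_binomial :: "('x, 'k::field) mpoly \<Rightarrow> bool" where
  "quadratic_binomial p \<longleftrightarrow> card (Poly_Mapping.keys p) = 2 \<and> total_degree p = 2"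

lemma monomials_add: "s \<in> monomials X \<Longrightarrow> t \<in> monomials X \<Longrightarrow> s + t \<in> monomials X"
  unfolding monomials_def using keys_add[of s t] by blast

lemma cring_poly_ring: "cring (poly_ring X :: ('x, 'k::field) mpoly ring)"
proof (rule cringI)
  show "abelian_group (poly_ring X :: ('x, 'k) mpoly ring)"
  proof (rule abelian_groupI)
    fix p :: "('x, 'k) mpoly"
    assume "p \<in> carrier (poly_ring X)"
    then show "\<exists>q\<in>carrier (poly_ring X). q \<oplus>\<^bsub>poly_ring X\<^esub> p = \<zero>\<^bsub>poly_ring X\<^esub>"
      by (intro bexI[of _ "- p"]) (auto simp: poly_ring_def)
  qed (use keys_add in \<open>force simp: poly_ring_def algebra_simps\<close>)+
  show "Group.comm_monoid (poly_ring X :: ('x, 'k) mpoly ring)"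
  proof (rule comm_monoidI)
    fix p q :: "('x, 'k) mpoly"
    assume "p \<in> carrier (poly_ring X)" "q \<in> carrier (poly_ring X)"
    moreover have "Poly_Mapping.keys (p * q)
        \<subseteq> {a + b | a b. a \<in> Poly_Mapping.keys p \<and> b \<in> Poly_Mapping.keys q}"
      by (rule keys_mult)
    ultimately show "p \<otimes>\<^bsub>poly_ring X\<^esub> q \<in> carrier (poly_ring X)"
      unfolding poly_ring_def by (fastforce intro: monomials_add)
  qed (auto simp: poly_ring_def monomials_def algebra_simps)
qed (auto simp: poly_ring_def algebra_simps)


section \<open>Monomial orders and Groebner bases\<close>

definition monomial_order :: "'x set \<Rightarrow> 'x mono rel \<Rightarrow> bool" where
  "monomial_order X r \<longleftrightarrow>
    linear_order_on (monomials X) r \<and>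
    (\<forall>m\<in>monomials X. (0, m) \<in> r) \<and>
    (\<forall>s t u. (s, t) \<in> r \<longrightarrow> u \<in> monomials X \<longrightarrow> (s + u, t + u) \<in> r)"

definition lead_monomial :: "'x mono rel \<Rightarrow> ('x, 'k::field) mpoly \<Rightarrow> 'x mono" where
  "lead_monomial r f = (THE m. m \<in> Poly_Mapping.keys f \<and> (\<forall>s\<in>Poly_Mapping.keys f. (s, m) \<in> r))"

definition initial_term :: "'x mono rel \<Rightarrow> ('x, 'k::field) mpoly \<Rightarrow> ('x, 'k) mpoly" where
  "initial_term r f = (if f = 0 then 0
     else Poly_Mapping.single (lead_monomial r f) (Poly_Mapping.lookup f (lead_monomial r f)))"

definition groebner_basis ::
    "'x set \<Rightarrow> 'x mono rel \<Rightarrow> ('x, 'k::field) mpoly set \<Rightarrow> ('x, 'k) mpoly set \<Rightarrow> bool" where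
  "groebner_basis X r I G \<longleftrightarrow>
    finite G \<and> G \<subseteq> I \<and> 0 \<notin> G \<and>
    Idl\<^bsub>poly_ring X\<^esub> (initial_term r ` G) = Idl\<^bsub>poly_ring X\<^esub> (initial_term r ` I)"

definition universal_groebner_basis ::
    "'x set \<Rightarrow> ('x, 'k::field) mpoly set \<Rightarrow> ('x, 'k) mpoly set \<Rightarrow> bool" where
  "universal_groebner_basis X I G \<longleftrightarrow> (\<forall>r. monomial_order X r \<longrightarrow> groebner_basis X r I G)"


section \<open>Unmixed ideals\<close>

text \<open>
  Krull dimension by chains of prime ideals. The zero ring gets the value 0 (a supremum over the
  empty set); this value is never used in \<open>unmixed\<close> below, since the zero ring has no
  associated primes.
\<close>

definition krull_dim :: "('a, 'b) ring_scheme \<Rightarrow> enat" where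
  "krull_dim R = Sup {enat n | n. \<exists>P :: nat \<Rightarrow> 'a set.
      (\<forall>i\<le>n. primeideal (P i) R) \<and> (\<forall>i<n. P i \<subset> P (Suc i))}"

text \<open>\<open>Ass_R(R/I)\<close>: the prime ideals of \<open>R\<close> that are annihilators of an element of the
  \<open>R\<close>-module \<open>R/I\<close>, on which \<open>a\<close> acts as multiplication by the coset \<open>I + a\<close>.\<close>

definition associated_primes :: "('a, 'b) ring_scheme \<Rightarrow> 'a set \<Rightarrow> 'a set set" where
  "associated_primes R I = {P. primeideal P R \<and>
     (\<exists>x\<in>carrier (R Quot I).
        P = {a \<in> carrier R. (I +>\<^bsub>R\<^esub> a) \<otimes>\<^bsub>R Quot I\<^esub> x = \<zero>\<^bsub>R Quot I\<^esub>})}"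

definition unmixed :: "('a, 'b) ring_scheme \<Rightarrow> 'a set \<Rightarrow> bool" where
  "unmixed R I \<longleftrightarrow>
    (\<forall>P\<in>associated_primes R I. krull_dim (R Quot I) = krull_dim (R Quot P))"


section \<open>Geometric vertex decomposability\<close>

text \<open>\<open>coeff_in y f j\<close> is the coefficient \<open>\<alpha>\<^sub>j\<close> of \<open>y\<^sup>j\<close> in \<open>f\<close>, a polynomial not involving \<open>y\<close>.\<close>

definition coeff_in :: "'x \<Rightarrow> ('x, 'k::field) mpoly \<Rightarrow> nat \<Rightarrow> ('x, 'k) mpoly" where
  "coeff_in y f j = (\<Sum>m | m \<in> Poly_Mapping.keys f \<and> Poly_Mapping.lookup m y = j.
     Poly_Mapping.single (m - Poly_Mapping.single y j) (Poly_Mapping.lookup f m))"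

text \<open>Only meaningful for \<open>f \<noteq> 0\<close>.\<close>

definition deg_in :: "'x \<Rightarrow> ('x, 'k::field) mpoly \<Rightarrow> nat" where
  "deg_in y f = Max {j. coeff_in y f j \<noteq> 0}"

definition lead_coeff_in :: "'x \<Rightarrow> ('x, 'k::field) mpoly \<Rightarrow> ('x, 'k) mpoly" where
  "lead_coeff_in y f = coeff_in y f (deg_in y f)"

definition init_in :: "'x \<Rightarrow> ('x, 'k::field) mpoly \<Rightarrow> ('x, 'k) mpoly" where
  "init_in y f = lead_coeff_in y f * var y ^ deg_in y f"

definition init_ideal_in ::
    "'x set \<Rightarrow> 'x \<Rightarrow> ('x, 'k::field) mpoly set \<Rightarrow> ('x, 'k) mpoly set" where
  "init_ideal_in X y I = Idl\<^bsub>poly_ring X\<^esub> (init_in y ` I)"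

text \<open>The coefficient field has to be passed explicitly as a type token, because the order
  itself does not mention it.\<close>

definition compatible_order ::
    "'k::field itself \<Rightarrow> 'x set \<Rightarrow> 'x \<Rightarrow> 'x mono rel \<Rightarrow> bool" where
  "compatible_order _ X y r \<longleftrightarrow> monomial_order X r \<and>
    (\<forall>f :: ('x, 'k) mpoly. f \<in> carrier (poly_ring X) \<longrightarrow>
       initial_term r f = initial_term r (init_in y f))"

text \<open>\<open>C\<^sub>y\<^sub>,\<^sub>I\<close> and \<open>N\<^sub>y\<^sub>,\<^sub>I\<close>, computed from a Groebner basis \<open>G\<close> of \<open>I\<close>.\<close>

definition C_ideal :: "'x set \<Rightarrow> 'x \<Rightarrow> ('x, 'k::field) mpoly set \<Rightarrow> ('x, 'k) mpoly set" where
  "C_ideal X y G = Idl\<^bsub>poly_ring X\<^esub> (lead_coeff_in y ` G)"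

definition N_ideal :: "'x set \<Rightarrow> 'x \<Rightarrow> ('x, 'k::field) mpoly set \<Rightarrow> ('x, 'k) mpoly set" where
  "N_ideal X y G = Idl\<^bsub>poly_ring X\<^esub> (lead_coeff_in y ` {g \<in> G. deg_in y g = 0})"

text \<open>
  \<open>geom_vertex_decomposable X I\<close>: the ideal \<open>I\<close> of \<open>K[X]\<close> is geometrically vertex decomposable.
  The convention on the ideals 0 and 1 of the ring \<open>K = K[{}]\<close> is covered by the
  first two rules.
\<close>

inductive geom_vertex_decomposable :: "'x set \<Rightarrow> ('x, 'k::field) mpoly set \<Rightarrow> bool" where
  unit_ideal:
    "\<lbrakk>unmixed (poly_ring X) I; I = carrier (poly_ring X)\<rbrakk>
      \<Longrightarrow> geom_vertex_decomposable X I"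
| variables:
    "\<lbrakk>unmixed (poly_ring X) I; Y \<subseteq> X; I = Idl\<^bsub>poly_ring X\<^esub> (var ` Y)\<rbrakk>
      \<Longrightarrow> geom_vertex_decomposable X I"
| decompose:
    "\<lbrakk>ideal I (poly_ring X);
      unmixed (poly_ring X) I;
      y \<in> X;
      compatible_order TYPE('k) X y r;
      groebner_basis X r I G;
      init_ideal_in X y I =
        C_ideal X y G \<inter> (N_ideal X y G <+>\<^bsub>poly_ring X\<^esub> Idl\<^bsub>poly_ring X\<^esub> {var y});
      geom_vertex_decomposable (X - {y}) (C_ideal X y G \<inter> carrier (poly_ring (X - {y})));
      geom_vertex_decomposable (X - {y}) (N_ideal X y G \<inter> carrier (poly_ring (X - {y})))\<rbrakk>
      \<Longrightarrow> geom_vertex_decomposable X I"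


section \<open>Toric ideals of graphs\<close>

definition finite_simple_graph :: "'v set \<Rightarrow> 'v set set \<Rightarrow> bool" where
  "finite_simple_graph V E \<longleftrightarrow> finite V \<and> (\<forall>e\<in>E. e \<subseteq> V \<and> card e = 2)"

text \<open>The variables of \<open>K[E(G)]\<close> are the edges themselves. The map \<open>toric_map\<close> is the
  \<open>K\<close>-algebra homomorphism sending the variable of an edge to the product of the variables of
  its two endpoints.\<close>

definition toric_map :: "('v set, 'k::field) mpoly \<Rightarrow> ('v, 'k) mpoly" where
  "toric_map p = (\<Sum>m\<in>Poly_Mapping.keys p. Poly_Mapping.single 0 (Poly_Mapping.lookup p m) *
     (\<Prod>e\<in>Poly_Mapping.keys m. (\<Prod>v\<in>e. var v) ^ Poly_Mapping.lookup m e))"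

definition toric_ideal :: "'v set \<Rightarrow> 'v set set \<Rightarrow> ('v set, 'k::field) mpoly set" where
  "toric_ideal V E = a_kernel (poly_ring E) (poly_ring V) toric_map"

end

theory Submission
  imports Defs "HOL-Library.Product_Plus"
begin

text \<open>
  The toric ideal of a graph is spanned by the differences \<open>m - m'\<close> of monomials in the edges with
  the same degree sequence on the vertices. Whatever has to be shown about it is therefore a statement
  about monomials, and the hypothesis is used only in the following form: for every lexicographic
  order, a monomial that is not the least of its degree is divisible by a quadratic monomial that is
  not the least of its degree (\<open>quadratic_rewriting\<close>, obtained in
  \<open>universal_quadratic_imp_rewriting\<close>). This form is inherited by subgraphs, by choosing an order in
  which the deleted edges come first.

  Fix an edge \<open>y\<close>. A quadratic binomial of the ideal in which \<open>y\<close> occurs has the form \<open>y z - q\<close> with \<open>q\<close>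
  free of \<open>y\<close>, because the graph is simple. Call such edges \<open>z\<close> the exchange partners of \<open>y\<close>. Thus the
  quadratic binomials are linear in \<open>y\<close>, \<open>N\<close> is the toric ideal of the graph without \<open>y\<close>, and \<open>C\<close> is
  generated by \<open>N\<close> and the exchange partners. The decisive point is that modulo the exchange
  partners \<open>C\<close> is again a toric ideal, namely that of the graph without \<open>y\<close> and its partners. That is, no
  binomial of \<open>N\<close> degenerates to a single monomial when the partners are set to 0. The reason is
  \<open>degree_drop_impossible\<close>: a product of \<open>y\<^sup>j\<close> with a monomial free of \<open>y\<close> and of its partners has not
  the same degree as any monomial with a smaller power of \<open>y\<close>. The proof is a single rewriting step
  in the order that puts \<open>y\<close> first and its partners next. The same lemma shows that initial
  forms in \<open>y\<close> of elements of the ideal lie in \<open>C\<close>, which is what the identity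
  \<open>in\<^sub>y(I) = C \<inter> (N + \<langle>y\<rangle>)\<close> requires (\<open>init_ideal_in_eq\<close>).

  So both \<open>C\<close> and \<open>N\<close> contract to kernels of algebra maps that send some edges to 0 and the others to
  the product of their endpoints, and the theorem follows by induction on the number of edges inside
  this family (\<open>edge_kernel_geom_vertex_decomposable\<close>). All these kernels are prime, as the
  target is an integral domain, and a prime ideal is its own only associated prime. Hence
  unmixedness holds without any computation of dimensions.
\<close>

abbreviation "keys \<equiv> Poly_Mapping.keys"
abbreviation "lookup \<equiv> Poly_Mapping.lookup"
abbreviation "single \<equiv> Poly_Mapping.single"

section \<open>Ideals of polynomial rings\<close>

lemma keys_add_mono: "keys (s + t) = keys s \<union> keys t" for s t :: "'x mono"
  by (auto simp: in_keys_iff lookup_add)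

lemma monomials_add_iff [simp]:
  "s + t \<in> monomials X \<longleftrightarrow> s \<in> monomials X \<and> t \<in> monomials X"
  by (auto simp: monomials_def keys_add_mono)

lemma carrier_poly_ring: "p \<in> carrier (poly_ring X) \<longleftrightarrow> keys p \<subseteq> monomials X"
  by (simp add: poly_ring_def)

lemma poly_ring_simps [simp]:
  "\<zero>\<^bsub>poly_ring X\<^esub> = 0" "\<one>\<^bsub>poly_ring X\<^esub> = 1"
  "p \<oplus>\<^bsub>poly_ring X\<^esub> q = p + q" "p \<otimes>\<^bsub>poly_ring X\<^esub> q = p * q"
  by (simp_all add: poly_ring_def)

lemma ring_poly_ring: "ring (poly_ring X :: ('x, 'k::field) mpoly ring)"
  using cring_poly_ring by (rule cring.axioms)

lemma single_in_poly_ring [simp]: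
  "single m c \<in> carrier (poly_ring X) \<longleftrightarrow> c = 0 \<or> m \<in> monomials X"
  by (simp add: carrier_poly_ring)

lemma poly_ring_closed:
  assumes "p \<in> carrier (poly_ring X)" "q \<in> carrier (poly_ring X)"
  shows "p + q \<in> carrier (poly_ring X)" "p * q \<in> carrier (poly_ring X)"
    "- p \<in> carrier (poly_ring X)" "p - q \<in> carrier (poly_ring X)"
proof -
  interpret cring "poly_ring X :: ('a, 'b) mpoly ring" by (rule cring_poly_ring)
  show 1: "p + q \<in> carrier (poly_ring X)" and "p * q \<in> carrier (poly_ring X)"
    using assms add.m_closed[of p q] m_closed[of p q] by auto
  have neg: "- r \<in> carrier (poly_ring X)" if "r \<in> carrier (poly_ring X)"
    for r :: "('a, 'b) mpoly"
    using that by (simp add: carrier_poly_ring)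
  show "- p \<in> carrier (poly_ring X)" using neg assms by blast
  show "p - q \<in> carrier (poly_ring X)"
    using assms(1) neg[OF assms(2)] add.m_closed[of p "- q"] by simp
qed

lemma poly_ring_mono: "X \<subseteq> Y \<Longrightarrow> carrier (poly_ring X) \<subseteq> carrier (poly_ring Y)"
  unfolding poly_ring_def monomials_def by fastforce

text \<open>
  Ideals of the locale-style ring, phrased with the arithmetic of the type: this lets everything
  below be computed with the operations of \<^typ>\<open>('x, 'k) mpoly\<close> itself.
\<close>

lemma ideal_poly_ringI:
  fixes I :: "('x, 'k::field) mpoly set"
  assumes "I \<subseteq> carrier (poly_ring X)" "0 \<in> I"
    and add: "\<And>p q. p \<in> I \<Longrightarrow> q \<in> I \<Longrightarrow> p + q \<in> I"
    and mult: "\<And>p q. p \<in> I \<Longrightarrow> q \<in> carrier (poly_ring X) \<Longrightarrow> q * p \<in> I"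
  shows "ideal I (poly_ring X)"
proof -
  interpret cring "poly_ring X :: ('x, 'k) mpoly ring" by (rule cring_poly_ring)
  have neg: "- p \<in> I" if "p \<in> I" for p
    using mult[OF that, of "- 1"] by (simp add: carrier_poly_ring monomials_def)
  have "\<ominus>\<^bsub>poly_ring X\<^esub> p = - p" if "p \<in> I" for p
    using minus_equality[of "- p" p] that neg assms(1) by auto
  then have "subgroup I (add_monoid (poly_ring X))"
    using assms(1,2) add neg by (intro add.subgroupI) (auto simp: a_inv_def)
  then show ?thesis
    using mult by (intro idealI) (auto simp: ring_poly_ring mult.commute)
qed

lemma ideal_poly_ringD:
  fixes I :: "('x, 'k::field) mpoly set"
  assumes "ideal I (poly_ring X)"
  shows "I \<subseteq> carrier (poly_ring X)" "0 \<in> I"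
    "p \<in> I \<Longrightarrow> q \<in> I \<Longrightarrow> p + q \<in> I"
    "p \<in> I \<Longrightarrow> q \<in> I \<Longrightarrow> p - q \<in> I"
    "p \<in> I \<Longrightarrow> r \<in> carrier (poly_ring X) \<Longrightarrow> r * p \<in> I"
proof -
  interpret ideal I "poly_ring X" by fact
  show "I \<subseteq> carrier (poly_ring X)" by (rule a_subset)
  show "0 \<in> I" using additive_subgroup.zero_closed[OF is_additive_subgroup] by simp
  show add: "p + q \<in> I" if "p \<in> I" "q \<in> I" for p q using additive_subgroup.a_closed[OF is_additive_subgroup that] by simp
  show mult: "r * p \<in> I" if "p \<in> I" "r \<in> carrier (poly_ring X)" for p r
    using I_l_closed[OF that] by simp
  show "p - q \<in> I" if "p \<in> I" "q \<in> I" for p q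
    using add[OF that(1) mult[OF that(2), of "- 1"]]
    by (simp add: carrier_poly_ring monomials_def)
qed

lemma ideal_Idl:
  fixes S :: "('x, 'k::field) mpoly set"
  shows "S \<subseteq> carrier (poly_ring X) \<Longrightarrow> ideal (Idl\<^bsub>poly_ring X\<^esub> S) (poly_ring X)"
  by (rule ring.genideal_ideal[OF ring_poly_ring])

lemma Idl_superset:
  fixes S :: "('x, 'k::field) mpoly set"
  shows "S \<subseteq> Idl\<^bsub>poly_ring X\<^esub> S"
  by (auto simp: genideal_def)

lemma Idl_least:
  fixes S :: "('x, 'k::field) mpoly set"
  shows "ideal I (poly_ring X) \<Longrightarrow> S \<subseteq> I \<Longrightarrow> Idl\<^bsub>poly_ring X\<^esub> S \<subseteq> I"
  by (rule ring.genideal_minimal[OF ring_poly_ring])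

text \<open>
  If \<open>I\<close> is prime, the annihilator of the coset of \<open>b\<close> is \<open>{a. a b \<in> I}\<close>, which is \<open>I\<close> for
  \<open>b \<notin> I\<close> and the whole ring for \<open>b \<in> I\<close>. So \<open>I\<close> is its own only associated prime and the
  dimension condition becomes trivial.
\<close>

lemma unmixed_if_prime_or_unit:
  fixes I :: "('x, 'k::field) mpoly set"
  assumes "primeideal I (poly_ring X) \<or> I = carrier (poly_ring X)"
  shows "unmixed (poly_ring X) I"
proof -
  interpret R: cring "poly_ring X :: ('x, 'k) mpoly ring" by (rule cring_poly_ring)
  have id: "ideal I (poly_ring X)"
    using assms primeideal.axioms(1) R.oneideal by auto
  have "P = I" if "P \<in> associated_primes (poly_ring X) I" for P
  proof -
    interpret I: ideal I "poly_ring X" by (rule id)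
    have P: "primeideal P (poly_ring X)" using that by (simp add: associated_primes_def)
    from that obtain x where x: "x \<in> carrier (poly_ring X Quot I)"
      and Px: "P = {a \<in> carrier (poly_ring X). (I +>\<^bsub>poly_ring X\<^esub> a) \<otimes>\<^bsub>poly_ring X Quot I\<^esub> x
                 = \<zero>\<^bsub>poly_ring X Quot I\<^esub>}"
      by (auto simp: associated_primes_def)
    from x obtain b where b: "b \<in> carrier (poly_ring X)" "x = I +>\<^bsub>poly_ring X\<^esub> b"
      by (auto simp: FactRing_def A_RCOSETS_def' )
    have *: "(I +>\<^bsub>poly_ring X\<^esub> a = I) \<longleftrightarrow> a \<in> I" if "a \<in> carrier (poly_ring X)" for a
      using that I.rcos_const_imp_mem I.a_rcos_const by blast
    have "(I +>\<^bsub>poly_ring X\<^esub> a) \<otimes>\<^bsub>poly_ring X Quot I\<^esub> x = \<zero>\<^bsub>poly_ring X Quot I\<^esub> \<longleftrightarrow> a * b \<in> I"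
      if "a \<in> carrier (poly_ring X)" for a
      using *[of "a * b"] I.rcoset_mult_add[OF that b(1)] poly_ring_closed(2)[OF that b(1)]
      by (simp add: FactRing_def b(2))
    then have P: "P = {a \<in> carrier (poly_ring X). a * b \<in> I}"
      unfolding Px by blast
    have "P \<noteq> carrier (poly_ring X)"
      using primeideal.I_notcarr[OF \<open>primeideal P (poly_ring X)\<close>] by auto
    then obtain a where a: "a \<in> carrier (poly_ring X)" "a * b \<notin> I" using P by blast
    have bI: "b \<notin> I" using ideal_poly_ringD(5)[OF id _ a(1)] a(2) by blast
    have "I \<noteq> carrier (poly_ring X)" using poly_ring_closed(2)[OF a(1) b(1)] a(2) by blast
    with assms have "primeideal I (poly_ring X)" by blast
    then have "a \<in> I" if "a \<in> carrier (poly_ring X)" "a * b \<in> I" for a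
      using primeideal.I_prime[of I "poly_ring X" a b] that bI b(1) by auto
    moreover have "a * b \<in> I" "a \<in> carrier (poly_ring X)" if "a \<in> I" for a
      using ideal_poly_ringD(1)[OF id] ideal_poly_ringD(5)[OF id that b(1)] that
      by (auto simp: mult.commute[of a b])
    ultimately show "P = I" using P by blast
  qed
  then show ?thesis by (auto simp: unmixed_def)
qed

section \<open>Kernels of graded specialisations\<close>

text \<open>
  The algebra map that sends the variables in \<open>Z\<close> to 0 and every other monomial \<open>m\<close> to the monomial
  with exponent \<open>A m\<close>. The exponents of the target may lie in any commutative monoid, so that one
  development covers both the toric map and its refinement by the degree in a chosen variable. The
  proper ideals to which the induction descends are all kernels of such maps.
\<close>

definition specialise :: "('x mono \<Rightarrow> 'm::comm_monoid_add) \<Rightarrow> 'x set \<Rightarrow> ('x, 'k::field) mpoly \<Rightarrow> 'm \<Rightarrow>\<^sub>0 'k"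
  where "specialise A Z p = (\<Sum>m | m \<in> keys p \<and> keys m \<inter> Z = {}. single (A m) (lookup p m))"

definition graded_kernel ::
    "('x mono \<Rightarrow> 'm::comm_monoid_add) \<Rightarrow> 'x set \<Rightarrow> 'x set \<Rightarrow> ('x, 'k::field) mpoly set"
  where "graded_kernel A X Z = {p \<in> carrier (poly_ring X). specialise A Z p = 0}"

lemma poly_eq_sum_single: "p = (\<Sum>m\<in>keys p. single m (lookup p m))"
proof (rule poly_mapping_eqI)
  fix k
  have "lookup (\<Sum>m\<in>keys p. single m (lookup p m)) k = (\<Sum>m\<in>keys p. if m = k then lookup p m else 0)"
    unfolding lookup_sum by (rule sum.cong) (auto simp: lookup_single when_def)
  then show "lookup p k = lookup (\<Sum>m\<in>keys p. single m (lookup p m)) k"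
    by (simp add: in_keys_iff)
qed

lemma specialise_eq_sum_superset:
  assumes "finite S" "keys p \<subseteq> S"
  shows "specialise A Z p = (\<Sum>m\<in>S. if keys m \<inter> Z = {} then single (A m) (lookup p m) else 0)"
proof -
  have "specialise A Z p = (\<Sum>m | m \<in> S \<and> keys m \<inter> Z = {}. single (A m) (lookup p m))"
    unfolding specialise_def using assms
    by (intro sum.mono_neutral_left) (auto simp: in_keys_iff)
  then show ?thesis by (simp add: sum.inter_filter[OF assms(1)])
qed

lemma specialise_single: "specialise A Z (single m c) = (if keys m \<inter> Z = {} then single (A m) c else 0)"
  by (subst specialise_eq_sum_superset[of "{m}"]) auto

lemma specialise_0 [simp]: "specialise A Z 0 = 0"
  by (simp add: specialise_def)

lemma specialise_add: "specialise A Z (p + q) = specialise A Z p + specialise A Z q"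
proof -
  let ?S = "keys p \<union> keys q"
  have "keys (p + q) \<subseteq> ?S" by (rule keys_add)
  then show ?thesis
    by (simp add: specialise_eq_sum_superset[of ?S] sum.distrib[symmetric] lookup_add single_add
        if_distrib cong: if_cong)
qed

lemma specialise_sum: "specialise A Z (sum f S) = (\<Sum>i\<in>S. specialise A Z (f i))"
  by (induction S rule: infinite_finite_induct) (simp_all add: specialise_add)

lemma specialise_mult:
  assumes A: "\<And>m n. A (m + n) = A m + A n"
  shows "specialise A Z (p * q) = specialise A Z p * specialise A Z q"
proof -
  have s: "specialise A Z (single m c * single n d) = specialise A Z (single m c) * specialise A Z (single n d)"
    for m n c d
    by (auto simp: mult_single specialise_single A keys_add_mono)
  have "specialise A Z (p * q) =
      specialise A Z ((\<Sum>m\<in>keys p. single m (lookup p m)) * (\<Sum>m\<in>keys q. single m (lookup q m)))"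
    by (simp flip: poly_eq_sum_single)
  also have "\<dots> = specialise A Z (\<Sum>m\<in>keys p. single m (lookup p m)) *
      specialise A Z (\<Sum>m\<in>keys q. single m (lookup q m))"
    by (simp add: sum_product specialise_sum s)
  finally show ?thesis by (simp flip: poly_eq_sum_single)
qed

lemma lookup_specialise:
  "lookup (specialise A Z p) c = (\<Sum>m | m \<in> keys p \<and> keys m \<inter> Z = {} \<and> A m = c. lookup p m)"
proof -
  have "lookup (specialise A Z p) c =
      (\<Sum>m | m \<in> keys p \<and> keys m \<inter> Z = {}. if A m = c then lookup p m else 0)"
    unfolding specialise_def lookup_sum by (rule sum.cong) (auto simp: lookup_single when_def)
  also have "\<dots> = (\<Sum>m | m \<in> {m. m \<in> keys p \<and> keys m \<inter> Z = {}} \<and> A m = c. lookup p m)"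
    by (subst sum.inter_filter[symmetric]) auto
  also have "{m. m \<in> {m. m \<in> keys p \<and> keys m \<inter> Z = {}} \<and> A m = c} =
      {m. m \<in> keys p \<and> keys m \<inter> Z = {} \<and> A m = c}" by auto
  finally show ?thesis .
qed

lemma ideal_graded_kernel:
  fixes A :: "'x mono \<Rightarrow> 'm::comm_monoid_add"
  assumes A: "\<And>m n. A (m + n) = A m + A n"
  shows "ideal (graded_kernel A X Z :: ('x, 'k::field) mpoly set) (poly_ring X)"
  by (rule ideal_poly_ringI)
    (auto simp: graded_kernel_def specialise_add specialise_mult[OF A] poly_ring_closed carrier_poly_ring[of 0])

lemma binomial_in_graded_kernel:
  assumes "m \<in> monomials X" "m' \<in> monomials X" "A m = A m'"
    and "keys m \<inter> Z = {} \<longleftrightarrow> keys m' \<inter> Z = {}"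
  shows "single m c - single m' c \<in> graded_kernel A X Z"
proof -
  have "specialise A Z (single m c + single m' (- c)) = 0"
    using assms unfolding specialise_add by (auto simp: specialise_single simp flip: single_add)
  moreover have "single m c + single m' (- c) = single m c - single m' c"
    by (simp add: single_uminus)
  moreover have "single m c - single m' c \<in> carrier (poly_ring X)"
    using assms by (intro poly_ring_closed) auto
  ultimately show ?thesis by (simp add: graded_kernel_def)
qed

text \<open>If a term of \<open>f\<close> survives the specialisation, another term has to cancel its image.\<close>

lemma graded_kernel_partner:
  assumes "f \<in> graded_kernel A X Z" "m \<in> keys f" "keys m \<inter> Z = {}"
  obtains m' where "m' \<in> keys f" "m' \<noteq> m" "keys m' \<inter> Z = {}" "A m' = A m"
proof -
  let ?S = "{n. n \<in> keys f \<and> keys n \<inter> Z = {} \<and> A n = A m}"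
  have "lookup (specialise A Z f) (A m) = 0" using assms(1) by (simp add: graded_kernel_def)
  then have "(\<Sum>n\<in>?S. lookup f n) = 0" by (simp add: lookup_specialise)
  moreover have "(\<Sum>n\<in>{m}. lookup f n) \<noteq> 0" using assms(2) by (simp add: in_keys_iff)
  ultimately have "?S \<noteq> {m}" by metis
  moreover have "m \<in> ?S" using assms by auto
  ultimately show ?thesis using that by blast
qed

text \<open>
  The kernel is spanned by the monomials that \<open>Z\<close> kills and the differences of two surviving
  monomials of equal degree: using \<open>graded_kernel_partner\<close>, each term of \<open>f\<close> can be removed
  by subtracting one such element without creating new terms.
\<close>

lemma graded_kernel_subset_ideal:
  assumes T: "ideal T (poly_ring X)"
    and A: "\<And>m n. A (m + n) = A m + A n"
    and Z: "\<And>m. m \<in> monomials Y \<Longrightarrow> keys m \<inter> Z \<noteq> {} \<Longrightarrow> single m 1 \<in> T"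
    and bin: "\<And>m m'. m \<in> monomials Y \<Longrightarrow> m' \<in> monomials Y \<Longrightarrow> keys m \<inter> Z = {} \<Longrightarrow>
        keys m' \<inter> Z = {} \<Longrightarrow> A m = A m' \<Longrightarrow> single m 1 - single m' 1 \<in> T"
  shows "(graded_kernel A Y Z :: ('x, 'k::field) mpoly set) \<subseteq> T"
proof
  fix f :: "('x, 'k) mpoly"
  assume "f \<in> graded_kernel A Y Z"
  then show "f \<in> T"
  proof (induction "card (keys f)" arbitrary: f rule: less_induct)
    case less
    note ker = ideal_graded_kernel[of A Y Z, OF A]
    have cT: "single 0 c * t \<in> T" if "t \<in> T" for c t
      using ideal_poly_ringD(5)[OF T that] by (simp add: monomials_def)
    show ?case
    proof (cases "f = 0")
      case True
      then show ?thesis using ideal_poly_ringD(2)[OF T] by simp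
    next
      case False
      then obtain m where m: "m \<in> keys f" by (metis all_not_in_conv keys_eq_empty)
      have mY: "keys f \<subseteq> monomials Y"
        using less.prems by (simp add: graded_kernel_def carrier_poly_ring)
      \<comment> \<open>Subtracting from f a suitable element t of both ideals removes the term at m.\<close>
      have "\<exists>t \<in> T \<inter> graded_kernel A Y Z. keys (f - t) \<subseteq> keys f - {m}"
      proof (cases "keys m \<inter> Z = {}")
        case False
        let ?t = "single m (lookup f m)"
        have "?t = single 0 (lookup f m) * single m 1" by (simp add: mult_single)
        then have "?t \<in> T" using cT[OF Z[OF _ False]] m mY by (metis subsetD)
        moreover have "?t \<in> graded_kernel A Y Z"
          using False m mY by (auto simp: graded_kernel_def specialise_single)
        moreover have "keys (f - ?t) \<subseteq> keys f - {m}"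
          by (auto simp: in_keys_iff lookup_minus lookup_single when_def split: if_splits)
        ultimately show ?thesis by blast
      next
        case True
        obtain m' where m': "m' \<in> keys f" "m' \<noteq> m" "keys m' \<inter> Z = {}" "A m' = A m"
          using graded_kernel_partner[OF less.prems m True] .
        let ?t = "single m (lookup f m) - single m' (lookup f m)"
        have "?t = single 0 (lookup f m) * (single m 1 - single m' 1)"
          by (simp add: mult_single algebra_simps)
        then have "?t \<in> T" using cT[OF bin[of m m']] m m' mY True by auto
        moreover have "?t \<in> graded_kernel A Y Z"
          using m m' mY True by (intro binomial_in_graded_kernel) auto
        moreover have "keys (f - ?t) \<subseteq> keys f - {m}"
          using m m' by (auto simp: in_keys_iff lookup_minus lookup_single when_def split: if_splits)
        ultimately show ?thesis by blast
      qed
      then obtain t where t: "t \<in> T" "t \<in> graded_kernel A Y Z" "keys (f - t) \<subseteq> keys f - {m}"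
        by blast
      then have "card (keys (f - t)) < card (keys f)"
        using m by (intro psubset_card_mono) auto
      moreover have "f - t \<in> graded_kernel A Y Z" using ideal_poly_ringD(4)[OF ker less.prems t(2)] .
      ultimately have "f - t \<in> T" by (rule less.hyps)
      from ideal_poly_ringD(3)[OF T this t(1)]
      show ?thesis by simp
    qed
  qed
qed

text \<open>
  Sums over the variables of a monomial that depend additively on the exponents are additive in the
  monomial, although the range of summation is not the same on the two sides.
\<close>

lemma sum_keys_add:
  fixes h :: "'x \<Rightarrow> nat \<Rightarrow> 'a::comm_monoid_add" and m n :: "'x mono"
  assumes "\<And>x. h x 0 = 0" "\<And>x i j. h x (i + j) = h x i + h x j"
  shows "(\<Sum>x\<in>keys (m + n). h x (lookup (m + n) x)) =
    (\<Sum>x\<in>keys m. h x (lookup m x)) + (\<Sum>x\<in>keys n. h x (lookup n x))"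
proof -
  let ?S = "keys m \<union> keys n"
  have "(\<Sum>x\<in>keys k. h x (lookup k x)) = (\<Sum>x\<in>?S. h x (lookup k x))" if "keys k \<subseteq> ?S" for k
    using that assms(1) by (intro sum.mono_neutral_left) (auto simp: in_keys_iff)
  then show ?thesis
    by (simp add: keys_add_mono lookup_add assms(2) sum.distrib)
qed

text \<open>
  Only finitely many variables occur in \<open>p\<close> and \<open>q\<close>. Numbering them is an injective regrading \<open>B\<close>
  into exponent vectors over \<^typ>\<open>nat\<close>, and polynomials over a linearly ordered set of variables
  have no zero divisors.
\<close>

lemma mpoly_no_zero_divisors:
  fixes p q :: "('x, 'k::field) mpoly"
  assumes "p \<noteq> 0" "q \<noteq> 0"
  shows "p * q \<noteq> 0"
proof -
  define W where "W = (\<Union>m\<in>keys p \<union> keys q. keys m)"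
  have "finite W" by (simp add: W_def)
  then obtain \<phi> :: "'x \<Rightarrow> nat" where \<phi>: "inj_on \<phi> W"
    using finite_imp_inj_to_nat_seg by metis
  define B :: "'x mono \<Rightarrow> nat mono" where
    "B m = (\<Sum>x\<in>keys m. single (\<phi> x) (lookup m x))" for m
  have B_add: "B (m + n) = B m + B n" for m n
    unfolding B_def by (rule sum_keys_add) (simp_all add: single_add)
  have lookup_B: "lookup (B m) (\<phi> x) = lookup m x" if "keys m \<subseteq> W" "x \<in> W" for m x
  proof -
    have "lookup (B m) (\<phi> x) = (\<Sum>z\<in>keys m. if z = x then lookup m z else 0)"
      unfolding B_def lookup_sum using that inj_onD[OF \<phi>]
      by (intro sum.cong) (auto simp: lookup_single when_def)
    then show ?thesis by (simp add: in_keys_iff)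
  qed
  have B_inj: "m = n" if "keys m \<subseteq> W" "keys n \<subseteq> W" "B m = B n" for m n
  proof (rule poly_mapping_eqI)
    fix x show "lookup m x = lookup n x"
    proof (cases "x \<in> W")
      case True
      then show ?thesis using lookup_B[OF that(1)] lookup_B[OF that(2)] that(3) by metis
    next
      case False
      then have "x \<notin> keys m" "x \<notin> keys n" using that(1,2) by blast+
      then show ?thesis by (simp add: in_keys_iff)
    qed
  qed
  \<comment> \<open>Regrading by an injective map does not merge terms.\<close>
  have "specialise B {} r \<noteq> 0" if r: "r \<noteq> 0" "(\<Union>m\<in>keys r. keys m) \<subseteq> W" for r :: "('x, 'k) mpoly"
  proof
    assume 0: "specialise B {} r = 0"
    from r obtain m where m: "m \<in> keys r" by (metis all_not_in_conv keys_eq_empty)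
    have "n = m" if "n \<in> keys r" "B n = B m" for n
      using r(2) m that by (intro B_inj) blast+
    then have "{n. n \<in> keys r \<and> keys n \<inter> {} = {} \<and> B n = B m} = {m}"
      using m by blast
    then have "lookup (specialise B {} r) (B m) = lookup r m" unfolding lookup_specialise by simp
    with 0 m show False by (simp add: in_keys_iff)
  qed
  then have "specialise B {} p * specialise B {} q \<noteq> 0"
    using assms by (auto simp: W_def)
  then show ?thesis using specialise_mult[OF B_add, where Z = "{}" and p = p and q = q] by auto
qed

text \<open>
  The quotient embeds into a polynomial ring, hence into an integral domain.
\<close>

lemma primeideal_graded_kernel:
  fixes A :: "'x mono \<Rightarrow> 'v mono"
  assumes A: "\<And>m n. A (m + n) = A m + A n"
  shows "primeideal (graded_kernel A X Z :: ('x, 'k::field) mpoly set) (poly_ring X)"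
proof (rule primeidealI[OF ideal_graded_kernel[OF A] cring_poly_ring])
  have "A 0 = 0" using A[of 0 0] by simp
  then have "specialise A Z (single 0 1) \<noteq> (0 :: 'v mono \<Rightarrow>\<^sub>0 'k)"
    by (subst specialise_single) simp
  then have "single 0 1 \<notin> (graded_kernel A X Z :: ('x, 'k) mpoly set)"
    by (simp add: graded_kernel_def)
  moreover have "single 0 1 \<in> carrier (poly_ring X :: ('x, 'k) mpoly ring)"
    by (subst single_in_poly_ring) (simp add: monomials_def)
  ultimately show "carrier (poly_ring X) \<noteq> (graded_kernel A X Z :: ('x, 'k) mpoly set)" by blast
next
  fix p q :: "('x, 'k) mpoly"
  assume "p \<in> carrier (poly_ring X)" "q \<in> carrier (poly_ring X)"
    and "p \<otimes>\<^bsub>poly_ring X\<^esub> q \<in> graded_kernel A X Z"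
  then show "p \<in> graded_kernel A X Z \<or> q \<in> graded_kernel A X Z"
    using mpoly_no_zero_divisors[of "specialise A Z p" "specialise A Z q"]
    by (auto simp: graded_kernel_def specialise_mult[OF A])
qed

section \<open>Lexicographic orders\<close>

text \<open>
  The first variable of the list is the most significant one. Lists with repetitions are allowed: a
  variable that occurs again has already been found equal, so the later occurrence decides nothing.
\<close>

fun lex_less :: "'x list \<Rightarrow> 'x mono rel" where
  "lex_less [] = {}"
| "lex_less (x # xs) = (\<lambda>m. lookup m x) <*mlex*> lex_less xs"

lemma wf_lex_less: "wf (lex_less xs)"
  by (induction xs) (auto intro: wf_mlex)

lemma lex_less_trans: "(s, t) \<in> lex_less xs \<Longrightarrow> (t, u) \<in> lex_less xs \<Longrightarrow> (s, u) \<in> lex_less xs"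
  by (induction xs) (auto simp: mlex_iff)

lemma lex_less_irrefl [simp]: "(s, s) \<notin> lex_less xs"
  by (induction xs) (auto simp: mlex_iff)

lemma lex_less_add [simp]: "(s + u, t + u) \<in> lex_less xs \<longleftrightarrow> (s, t) \<in> lex_less xs"
  by (induction xs) (auto simp: mlex_iff lookup_add)

lemma lex_less_append:
  "(s, t) \<in> lex_less (ys @ zs) \<longleftrightarrow> (s, t) \<in> lex_less ys \<or>
    (\<forall>y\<in>set ys. lookup s y = lookup t y) \<and> (s, t) \<in> lex_less zs"
  by (induction ys) (auto simp: mlex_iff)

lemma lex_less_zero:
  "\<forall>y\<in>set ys. lookup t y = 0 \<Longrightarrow> (s, t) \<notin> lex_less ys"
  by (induction ys) (auto simp: mlex_iff)

lemma lex_less_total: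
  assumes "s \<in> monomials (set xs)" "t \<in> monomials (set xs)" "s \<noteq> t"
  shows "(s, t) \<in> lex_less xs \<or> (t, s) \<in> lex_less xs"
proof -
  have "(\<forall>x\<in>set xs. lookup s x = lookup t x) \<or> (s, t) \<in> lex_less xs \<or> (t, s) \<in> lex_less xs"
    by (induction xs) (auto simp: mlex_iff)
  moreover have "\<not> (\<forall>x\<in>set xs. lookup s x = lookup t x)"
  proof
    assume "\<forall>x\<in>set xs. lookup s x = lookup t x"
    moreover have "lookup s x = 0 \<and> lookup t x = 0" if "x \<notin> set xs" for x
      using assms(1,2) that by (auto simp: monomials_def in_keys_iff subset_iff)
    ultimately show False using assms(3) by (metis poly_mapping_eqI)
  qed
  ultimately show ?thesis by blast
qed

text \<open>
  The elimination property: below a monomial that avoids the most significant variables there are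
  only monomials that avoid them as well.
\<close>

lemma lex_less_append_avoiding:
  assumes "(s, t) \<in> lex_less (ys @ zs)" "keys t \<inter> set ys = {}"
  shows "keys s \<inter> set ys = {}" "(s, t) \<in> lex_less zs"
proof -
  have "(s, t) \<notin> lex_less ys"
    using assms(2) by (intro lex_less_zero) (auto simp: in_keys_iff)
  then show "keys s \<inter> set ys = {}" "(s, t) \<in> lex_less zs"
    using assms by (auto simp: lex_less_append in_keys_iff)
qed

lemma finite_lex_greatest:
  assumes "finite K" "K \<noteq> {}" "K \<subseteq> monomials (set xs)"
  obtains m where "m \<in> K" "\<And>s. s \<in> K \<Longrightarrow> s = m \<or> (s, m) \<in> lex_less xs"
proof -
  from assms have "\<exists>m\<in>K. \<forall>s\<in>K. s = m \<or> (s, m) \<in> lex_less xs"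
  proof (induction K rule: finite_ne_induct)
    case (insert k K)
    then obtain m where m: "m \<in> K" "\<forall>s\<in>K. s = m \<or> (s, m) \<in> lex_less xs" by auto
    from lex_less_total[of k xs m] insert.prems m insert.hyps
    consider "(k, m) \<in> lex_less xs" | "(m, k) \<in> lex_less xs" by auto
    then show ?case
      using m by cases (auto intro: lex_less_trans)
  qed auto
  then show ?thesis using that by blast
qed

definition lex_order :: "'x list \<Rightarrow> 'x mono rel" where
  "lex_order xs = {(s, t). s \<in> monomials (set xs) \<and> t \<in> monomials (set xs) \<and>
     (s = t \<or> (s, t) \<in> lex_less xs)}"

lemma monomial_order_lex_order: "monomial_order (set xs) (lex_order xs)"
proof -
  have "linear_order_on (monomials (set xs)) (lex_order xs)"
    unfolding linear_order_on_def partial_order_on_def preorder_on_def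
    using lex_less_total[of _ xs]
    by (auto simp: lex_order_def refl_on_def trans_def antisym_def total_on_def
        intro: lex_less_trans dest: lex_less_trans)
  moreover have "(0, m) \<in> lex_order xs" if "m \<in> monomials (set xs)" for m
  proof -
    have "(m, 0) \<notin> lex_less xs" by (rule lex_less_zero) simp
    then show ?thesis
      using that lex_less_total[of 0 xs m] by (auto simp: lex_order_def monomials_def)
  qed
  ultimately show ?thesis by (auto simp: monomial_order_def lex_order_def)
qed

lemma lead_monomial_lexI:
  assumes "m \<in> keys f" "\<And>s. s \<in> keys f \<Longrightarrow> s = m \<or> (s, m) \<in> lex_less xs"
    and "f \<in> carrier (poly_ring (set xs))"
  shows "lead_monomial (lex_order xs) f = m"
  unfolding lead_monomial_def
proof (rule the_equality)
  show "m \<in> keys f \<and> (\<forall>s\<in>keys f. (s, m) \<in> lex_order xs)"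
    using assms by (auto simp: lex_order_def carrier_poly_ring)
  show "n = m" if n: "n \<in> keys f \<and> (\<forall>s\<in>keys f. (s, n) \<in> lex_order xs)" for n
  proof (rule ccontr)
    assume "n \<noteq> m"
    then have "(n, m) \<in> lex_less xs" "(m, n) \<in> lex_less xs"
      using n assms(1,2) by (auto simp: lex_order_def)
    then show False using lex_less_trans lex_less_irrefl by blast
  qed
qed

lemma lead_monomial_lex:
  assumes "f \<noteq> 0" "f \<in> carrier (poly_ring (set xs))"
  shows "lead_monomial (lex_order xs) f \<in> keys f"
    "s \<in> keys f \<Longrightarrow> s \<noteq> lead_monomial (lex_order xs) f \<Longrightarrow>
      (s, lead_monomial (lex_order xs) f) \<in> lex_less xs"
proof -
  obtain m where "m \<in> keys f" "\<And>s. s \<in> keys f \<Longrightarrow> s = m \<or> (s, m) \<in> lex_less xs"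
    using finite_lex_greatest[of "keys f" xs] assms by (auto simp: carrier_poly_ring)
  with lead_monomial_lexI[OF this assms(2)]
  show "lead_monomial (lex_order xs) f \<in> keys f"
    "s \<in> keys f \<Longrightarrow> s \<noteq> lead_monomial (lex_order xs) f \<Longrightarrow>
      (s, lead_monomial (lex_order xs) f) \<in> lex_less xs" by auto
qed

section \<open>Initial forms with respect to one variable\<close>

lemma mono_split: "lookup m y = d \<Longrightarrow> m = (m - single y d) + single y d" for m :: "'x mono"
  by (rule poly_mapping_eqI) (auto simp: lookup_add lookup_minus lookup_single when_def)

lemma var_power: "(var y :: ('x, 'k::field) mpoly) ^ d = single (single y d) 1"
proof (induction d)
  case (Suc d)
  then show ?case
    by (simp add: var_def mult_single flip: single_add)
qed simp

lemma lookup_coeff_in: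
  "lookup (coeff_in y f j) m = (if lookup m y = 0 then lookup f (m + single y j) else 0)"
proof -
  have *: "n - single y j = m \<and> lookup n y = j \<longleftrightarrow> lookup m y = 0 \<and> n = m + single y j" for n
    using mono_split[of n y j]
    by (auto simp: lookup_add lookup_minus)
  have "lookup (coeff_in y f j) m =
      (\<Sum>n | n \<in> keys f \<and> lookup n y = j. if n - single y j = m then lookup f n else 0)"
    unfolding coeff_in_def lookup_sum by (rule sum.cong) (auto simp: lookup_single when_def)
  also have "\<dots> = (\<Sum>n | n \<in> {n \<in> keys f. lookup n y = j} \<and> n - single y j = m. lookup f n)"
    by (subst sum.inter_filter[symmetric]) auto
  also have "{n. n \<in> {n \<in> keys f. lookup n y = j} \<and> n - single y j = m} =
      {n \<in> keys f. n - single y j = m \<and> lookup n y = j}"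
    by blast
  also have "\<dots> = (if lookup m y = 0 \<and> m + single y j \<in> keys f then {m + single y j} else {})"
    unfolding * by auto
  finally show ?thesis by (simp add: in_keys_iff split: if_splits)
qed

lemma coeff_in_zero [simp]: "coeff_in y 0 j = 0"
  by (simp add: coeff_in_def)

lemma deg_in_eq_Max:
  shows "deg_in y f = Max ((\<lambda>m. lookup m y) ` keys f)"
proof -
  have "coeff_in y f j \<noteq> 0 \<longleftrightarrow> j \<in> (\<lambda>m. lookup m y) ` keys f" for j
  proof
    assume "coeff_in y f j \<noteq> 0"
    then obtain m where "lookup (coeff_in y f j) m \<noteq> 0" by (metis poly_mapping_eqI lookup_zero)
    then have "m + single y j \<in> keys f" "lookup (m + single y j) y = j"
      by (auto simp: lookup_coeff_in in_keys_iff lookup_add split: if_splits)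
    then show "j \<in> (\<lambda>m. lookup m y) ` keys f" by force
  next
    assume "j \<in> (\<lambda>m. lookup m y) ` keys f"
    then obtain m where m: "m \<in> keys f" "lookup m y = j" by auto
    then have "lookup (coeff_in y f j) (m - single y j) \<noteq> 0"
      using mono_split[OF m(2)] by (auto simp: lookup_coeff_in lookup_minus in_keys_iff)
    then show "coeff_in y f j \<noteq> 0" by auto
  qed
  then have "{j. coeff_in y f j \<noteq> 0} = (\<lambda>m. lookup m y) ` keys f" by auto
  then show ?thesis by (simp add: deg_in_def)
qed

lemma deg_in_ge: "m \<in> keys f \<Longrightarrow> lookup m y \<le> deg_in y f"
  by (simp add: deg_in_eq_Max)

lemma deg_in_attained:
  assumes "f \<noteq> 0" obtains m where "m \<in> keys f" "lookup m y = deg_in y f"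
proof -
  have "deg_in y f \<in> (\<lambda>m. lookup m y) ` keys f"
    unfolding deg_in_eq_Max using assms by (intro Max_in) auto
  then show ?thesis using that by auto
qed

lemma deg_inI: "m \<in> keys f \<Longrightarrow> lookup m y = d \<Longrightarrow> (\<And>n. n \<in> keys f \<Longrightarrow> lookup n y \<le> d) \<Longrightarrow> deg_in y f = d"
  unfolding deg_in_eq_Max by (intro Max_eqI) auto

lemma init_in_eq_sum:
  "init_in y f = (\<Sum>m | m \<in> keys f \<and> lookup m y = deg_in y f. single m (lookup f m))"
  unfolding init_in_def lead_coeff_in_def coeff_in_def var_power sum_distrib_right
  by (rule sum.cong) (auto simp: mult_single mono_split[symmetric])

lemma lookup_init_in:
  "lookup (init_in y f) m = (if lookup m y = deg_in y f then lookup f m else 0)"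
proof -
  have "lookup (init_in y f) m =
      (\<Sum>n | n \<in> keys f \<and> lookup n y = deg_in y f. if n = m then lookup f n else 0)"
    unfolding init_in_eq_sum lookup_sum by (rule sum.cong) (auto simp: lookup_single when_def)
  then show ?thesis by (auto simp: in_keys_iff)
qed

lemma keys_init_in: "keys (init_in y f) = {m \<in> keys f. lookup m y = deg_in y f}"
  by (auto simp: in_keys_iff lookup_init_in split: if_splits)

text \<open>
  With \<open>y\<close> as most significant variable, the leading monomial has the largest possible degree in
  \<open>y\<close> and therefore survives in the initial form.
\<close>

lemma compatible_lex_order:
  fixes y :: 'x
  assumes X: "X = set (y # xs)"
  shows "compatible_order TYPE('k::field) X y (lex_order (y # xs))"
  unfolding compatible_order_def
proof (intro conjI allI impI)
  show "monomial_order X (lex_order (y # xs))"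
    unfolding X by (rule monomial_order_lex_order)
next
  fix f :: "('x, 'k) mpoly"
  assume f: "f \<in> carrier (poly_ring X)"
  let ?r = "lex_order (y # xs)"
  show "initial_term ?r f = initial_term ?r (init_in y f)"
  proof (cases "f = 0")
    case True
    then show ?thesis by (simp add: init_in_def lead_coeff_in_def)
  next
    case False
    let ?m = "lead_monomial ?r f"
    have lead: "?m \<in> keys f" "\<And>s. s \<in> keys f \<Longrightarrow> s = ?m \<or> (s, ?m) \<in> lex_less (y # xs)"
      using lead_monomial_lex[OF False f[unfolded X]] by blast+
    obtain n where n: "n \<in> keys f" "lookup n y = deg_in y f" using deg_in_attained[OF False] .
    have "lookup n y \<le> lookup ?m y" using lead(2)[OF n(1)] by (auto simp: mlex_iff)
    then have m: "lookup ?m y = deg_in y f" using n deg_in_ge[OF lead(1), of y] by simp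
    have "lead_monomial ?r (init_in y f) = ?m"
      using lead m f by (intro lead_monomial_lexI) (auto simp: keys_init_in carrier_poly_ring X)
    moreover have "init_in y f \<noteq> 0" using lead m by (metis (mono_tags, lifting) keys_init_in
        empty_iff keys_zero mem_Collect_eq)
    ultimately show ?thesis using False m by (simp add: initial_term_def lookup_init_in)
  qed
qed

section \<open>Toric ideals as kernels\<close>

definition edge_degree :: "'v set mono \<Rightarrow> 'v mono" where
  "edge_degree m = (\<Sum>e\<in>keys m. \<Sum>v\<in>e. single v (lookup m e))"

lemma edge_degree_add: "edge_degree (m + n) = edge_degree m + edge_degree n"
  unfolding edge_degree_def
  by (rule sum_keys_add) (simp_all add: single_add sum.distrib)

lemma edge_degree_single: "edge_degree (single e k) = (\<Sum>v\<in>e. single v k)"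
  by (cases "k = 0") (simp_all add: edge_degree_def)

lemma prod_single_one: "(\<Prod>i\<in>S. single (f i) 1) = (single (\<Sum>i\<in>S. f i) 1 :: ('v, 'k::field) mpoly)"
  by (induction S rule: infinite_finite_induct) (simp_all add: mult_single)

lemma toric_map_eq_specialise:
  fixes p :: "('v set, 'k::field) mpoly"
  shows "toric_map p = specialise edge_degree {} p"
  unfolding toric_map_def specialise_def
proof (rule sum.cong)
  fix m assume "m \<in> {m \<in> keys p. keys m \<inter> {} = {}}"
  have "(\<Prod>v\<in>e. var v :: ('v, 'k) mpoly) ^ k = single (\<Sum>v\<in>e. single v k) 1" for e :: "'v set" and k
    by (simp add: prod_power_distrib var_power prod_single_one)
  then show "single 0 (lookup p m) * (\<Prod>e\<in>keys m. (\<Prod>v\<in>e. var v) ^ lookup m e) =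
      single (edge_degree m) (lookup p m)"
    by (simp add: prod_single_one mult_single edge_degree_def)
qed simp

lemma toric_ideal_eq_graded_kernel: "toric_ideal V E = graded_kernel edge_degree E {}"
  by (auto simp: toric_ideal_def graded_kernel_def a_kernel_def' toric_map_eq_specialise)

section \<open>Rewriting by quadratic binomials\<close>

definition quadratic_monomials :: "'x set \<Rightarrow> 'x mono set" where
  "quadratic_monomials X = {single a 1 + single b 1 | a b. a \<in> X \<and> b \<in> X}"

definition quadratic_binomials :: "'v set set \<Rightarrow> ('v set, 'k::field) mpoly set" where
  "quadratic_binomials X = {single q 1 - single q' 1 | q q'.
     q \<in> quadratic_monomials X \<and> q' \<in> quadratic_monomials X \<and>
     edge_degree q = edge_degree q' \<and> q \<noteq> q'}"

text \<open>
  What remains of a universal quadratic Groebner basis of the toric ideal when only lexicographic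
  orders are considered: a monomial that is not the smallest of its degree is divisible by a quadratic
  monomial \<open>q\<close> with the same property, and can thus be rewritten by the binomial \<open>q - q'\<close>.
  In contrast to the existence of the basis, this condition mentions monomials only and visibly passes
  to subgraphs.
\<close>

definition quadratic_rewriting :: "'v set set \<Rightarrow> bool" where
  "quadratic_rewriting X \<longleftrightarrow> (\<forall>xs m m'. set xs = X \<longrightarrow> m \<in> monomials X \<longrightarrow> m' \<in> monomials X \<longrightarrow>
     edge_degree m = edge_degree m' \<longrightarrow> (m', m) \<in> lex_less xs \<longrightarrow>
     (\<exists>q q' s. q \<in> quadratic_monomials X \<and> q' \<in> quadratic_monomials X \<and> m = q + s \<and>
        edge_degree q = edge_degree q' \<and> (q', q) \<in> lex_less xs))"

lemma quadratic_monomials_subset: "quadratic_monomials X \<subseteq> monomials X"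
  by (auto simp: quadratic_monomials_def monomials_def keys_add_mono)

lemma quadratic_monomials_restrict:
  assumes "q \<in> quadratic_monomials X" "q \<in> monomials Y"
  shows "q \<in> quadratic_monomials Y"
proof -
  obtain a b where q: "q = single a 1 + single b 1"
    using assms(1) by (auto simp: quadratic_monomials_def)
  then have "a \<in> Y" "b \<in> Y" using assms(2) by (auto simp: monomials_def keys_add_mono)
  then show ?thesis unfolding quadratic_monomials_def q by blast
qed

lemma quadratic_binomialsI:
  "q \<in> quadratic_monomials X \<Longrightarrow> q' \<in> quadratic_monomials X \<Longrightarrow>
    edge_degree q = edge_degree q' \<Longrightarrow> q \<noteq> q' \<Longrightarrow> single q 1 - single q' 1 \<in> quadratic_binomials X"
  by (auto simp: quadratic_binomials_def)

lemma quadratic_monomials_mono: "X \<subseteq> Y \<Longrightarrow> quadratic_monomials X \<subseteq> quadratic_monomials Y"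
  by (auto simp: quadratic_monomials_def)

lemma quadratic_binomials_mono: "X \<subseteq> Y \<Longrightarrow> quadratic_binomials X \<subseteq> quadratic_binomials Y"
  using quadratic_monomials_mono[of X Y] by (fastforce simp: quadratic_binomials_def)

lemma finite_quadratic_binomials:
  assumes "finite X"
  shows "finite (quadratic_binomials X :: ('v set, 'k::field) mpoly set)"
proof -
  have "quadratic_monomials X = (\<lambda>(a, b). single a 1 + single b 1) ` (X \<times> X)"
    by (auto simp: quadratic_monomials_def)
  then have "finite (quadratic_monomials X)" using assms by simp
  moreover have "quadratic_binomials X \<subseteq> (\<lambda>(q, q'). single q 1 - single q' 1 :: ('v set, 'k) mpoly) `
      (quadratic_monomials X \<times> quadratic_monomials X)"
    by (auto simp: quadratic_binomials_def)
  ultimately show ?thesis by (meson finite_SigmaI finite_imageI finite_subset)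
qed

lemma monomials_Diff: "m \<in> monomials (X - Z) \<longleftrightarrow> m \<in> monomials X \<and> keys m \<inter> Z = {}"
  by (auto simp: monomials_def)

text \<open>
  Deleting variables is an elimination: if the deleted variables are placed in front, a quadratic
  rewriting step that starts in \<open>Y\<close> also ends in \<open>Y\<close>.
\<close>

lemma quadratic_rewriting_subset:
  assumes "quadratic_rewriting X" "finite X" "Y \<subseteq> X"
  shows "quadratic_rewriting Y"
  unfolding quadratic_rewriting_def
proof (intro allI impI)
  fix zs m m'
  assume zs: "set zs = Y" and m: "m \<in> monomials Y" "m' \<in> monomials Y"
    "edge_degree m = edge_degree m'" "(m', m) \<in> lex_less zs"
  obtain ys where ys: "set ys = X - Y" using assms(2) finite_list[of "X - Y"] by auto
  have off: "lookup n x = 0" if "n \<in> monomials Y" "x \<in> set ys" for n x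
    using that ys by (auto simp: monomials_def in_keys_iff subset_iff)
  have "set (ys @ zs) = X" "m \<in> monomials X" "m' \<in> monomials X" "(m', m) \<in> lex_less (ys @ zs)"
    using ys zs m assms(3) off[OF m(1)] off[OF m(2)] by (auto simp: lex_less_append monomials_def)
  then obtain q q' s where q: "q \<in> quadratic_monomials X" "q' \<in> quadratic_monomials X" "m = q + s"
      "edge_degree q = edge_degree q'" "(q', q) \<in> lex_less (ys @ zs)"
    using assms(1) m(3) unfolding quadratic_rewriting_def by metis
  have qY: "q \<in> monomials Y" using m(1) q(3) by simp
  then have "keys q \<inter> set ys = {}" using ys by (auto simp: monomials_def)
  note * = lex_less_append_avoiding[OF q(5) this]
  have "q' \<in> monomials Y"
    using *(1) q(2) quadratic_monomials_subset ys by (fastforce simp: monomials_def)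
  then show "\<exists>q q' s. q \<in> quadratic_monomials Y \<and> q' \<in> quadratic_monomials Y \<and> m = q + s \<and>
        edge_degree q = edge_degree q' \<and> (q', q) \<in> lex_less zs"
    using q qY *(2) quadratic_monomials_restrict by metis
qed

lemma lex_less_filter:
  assumes "s \<in> monomials Y" "t \<in> monomials Y"
  shows "(s, t) \<in> lex_less (filter (\<lambda>x. x \<in> Y) xs) \<longleftrightarrow> (s, t) \<in> lex_less xs"
proof (induction xs)
  case (Cons x xs)
  have "lookup s x = 0 \<and> lookup t x = 0" if "x \<notin> Y"
    using assms that by (auto simp: monomials_def in_keys_iff subset_iff)
  with Cons show ?case by (auto simp: mlex_iff)
qed simp

text \<open>
  Variables of the order outside \<open>Y\<close> have exponent 0 in all monomials over \<open>Y\<close> and do not influence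
  any comparison.
\<close>

lemma quadratic_rewriting_step:
  assumes "quadratic_rewriting Y" "Y \<subseteq> set xs" "m \<in> monomials Y" "m' \<in> monomials Y"
    "edge_degree m = edge_degree m'" "(m', m) \<in> lex_less xs"
  obtains q q' s where "q \<in> quadratic_monomials Y" "q' \<in> quadratic_monomials Y" "m = q + s"
    "edge_degree q = edge_degree q'" "(q', q) \<in> lex_less xs"
proof -
  let ?zs = "filter (\<lambda>x. x \<in> Y) xs"
  have "set ?zs = Y" using assms(2) by auto
  moreover have "(m', m) \<in> lex_less ?zs" using assms lex_less_filter[of m' Y m xs] by simp
  ultimately obtain q q' s where q: "q \<in> quadratic_monomials Y" "q' \<in> quadratic_monomials Y"
      "m = q + s" "edge_degree q = edge_degree q'" "(q', q) \<in> lex_less ?zs"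
    using assms unfolding quadratic_rewriting_def by metis
  moreover have "(q', q) \<in> lex_less xs"
    using q quadratic_monomials_subset lex_less_filter[of q' Y q xs] by blast
  ultimately show ?thesis using that by blast
qed

text \<open>
  Rewriting with quadratic binomials terminates in the least monomial of the given degree, and each
  step changes the monomial by an element of \<open>T\<close>. Monomials of equal degree share this normal form.
\<close>

lemma binomial_in_ideal:
  fixes T :: "('v set, 'k::field) mpoly set"
  assumes T: "ideal T (poly_ring X)" and "Y \<subseteq> X" "finite Y" "quadratic_rewriting Y"
    and bin: "quadratic_binomials Y \<subseteq> T"
    and m: "m \<in> monomials Y" "m' \<in> monomials Y" "edge_degree m = edge_degree m'"
  shows "single m 1 - single m' 1 \<in> T"
proof -
  obtain xs where xs: "set xs = Y" using finite_list[OF \<open>finite Y\<close>] by auto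
  define least where "least n \<longleftrightarrow>
    (\<forall>n'\<in>monomials Y. edge_degree n' = edge_degree n \<longrightarrow> (n', n) \<notin> lex_less xs)" for n
  have normal_form: "\<exists>l\<in>monomials Y. least l \<and> edge_degree l = edge_degree n \<and> single n 1 - single l 1 \<in> T"
    if "n \<in> monomials Y" for n
    using that
  proof (induction n rule: wf_induct_rule[OF wf_lex_less[of xs]])
    case (1 n)
    show ?case
    proof (cases "least n")
      case True
      then show ?thesis using 1 ideal_poly_ringD(2)[OF T] by auto
    next
      case False
      then obtain n' where "n' \<in> monomials Y" "edge_degree n' = edge_degree n" "(n', n) \<in> lex_less xs"
        by (auto simp: least_def)
      then obtain q q' s where q: "q \<in> quadratic_monomials Y" "q' \<in> quadratic_monomials Y"
          "n = q + s" "edge_degree q = edge_degree q'" "(q', q) \<in> lex_less xs"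
        using quadratic_rewriting_step[OF assms(4) _ 1(2), of xs n'] xs by auto
      have s: "s \<in> monomials Y" and "q' + s \<in> monomials Y"
        using 1(2) q(2,3) quadratic_monomials_subset by auto
      moreover have "(q' + s, n) \<in> lex_less xs" using q by simp
      ultimately obtain l where l: "l \<in> monomials Y" "least l" "edge_degree l = edge_degree (q' + s)"
          "single (q' + s) 1 - single l 1 \<in> T"
        using 1(1) by blast
      have "single q 1 - single q' 1 \<in> T"
        using q by (intro subsetD[OF bin] quadratic_binomialsI) auto
      then have "single s 1 * (single q 1 - single q' 1) \<in> T"
        by (rule ideal_poly_ringD(5)[OF T]) (use s \<open>Y \<subseteq> X\<close> in \<open>auto simp: monomials_def\<close>)
      then have "single n 1 - single (q' + s) 1 \<in> T"
        by (simp add: q(3) algebra_simps mult_single)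
      from ideal_poly_ringD(3)[OF T this l(4)] have "single n 1 - single l 1 \<in> T" by simp
      moreover have "edge_degree l = edge_degree n"
        using l(3) q by (simp add: edge_degree_add)
      ultimately show ?thesis using l(1,2) by blast
    qed
  qed
  obtain l where l: "l \<in> monomials Y" "least l" "edge_degree l = edge_degree m" "single m 1 - single l 1 \<in> T"
    using normal_form[OF m(1)] by blast
  obtain l' where l': "l' \<in> monomials Y" "least l'" "edge_degree l' = edge_degree m'"
      "single m' 1 - single l' 1 \<in> T"
    using normal_form[OF m(2)] by blast
  have "l = l'"
    using l l' m(3) lex_less_total[of l xs l'] xs by (auto simp: least_def)
  with ideal_poly_ringD(4)[OF T l(4) l'(4)] show ?thesis by simp
qed

lemma split_off_variable:
  fixes m :: "'x mono"
  assumes "z \<in> keys m"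
  shows "m = (m - single z 1) + single z 1"
proof -
  have "lookup m z = Suc (lookup m z - 1)" using assms by (simp add: in_keys_iff)
  then show ?thesis
    by (intro poly_mapping_eqI) (auto simp: lookup_add lookup_minus lookup_single when_def)
qed

lemma monomial_in_ideal:
  fixes T :: "('x, 'k::field) mpoly set"
  assumes T: "ideal T (poly_ring X)" and "var ` Z \<subseteq> T" "m \<in> monomials X" "keys m \<inter> Z \<noteq> {}"
  shows "single m 1 \<in> T"
proof -
  obtain z where z: "z \<in> keys m" "z \<in> Z" using assms(4) by auto
  note m = split_off_variable[OF z(1)]
  have "m - single z 1 \<in> monomials X" using assms(3) m by (metis monomials_add_iff)
  then have "single (m - single z 1) 1 * var z \<in> T"
    using z(2) assms(2) by (intro ideal_poly_ringD(5)[OF T]) auto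
  then show ?thesis using m by (simp add: var_def mult_single)
qed

lemma edge_kernel_subset_ideal:
  fixes T :: "('v set, 'k::field) mpoly set"
  assumes T: "ideal T (poly_ring X)" and "Y \<subseteq> X" "finite Y" "quadratic_rewriting (Y - Z)"
    and "var ` Z \<subseteq> T" "quadratic_binomials (Y - Z) \<subseteq> T"
  shows "graded_kernel edge_degree Y Z \<subseteq> T"
proof (rule graded_kernel_subset_ideal[OF T edge_degree_add])
  show "single m 1 \<in> T" if "m \<in> monomials Y" "keys m \<inter> Z \<noteq> {}" for m
    using that assms(2) by (intro monomial_in_ideal[OF T assms(5)]) (auto simp: monomials_def)
  show "single m 1 - single m' 1 \<in> T"
    if "m \<in> monomials Y" "m' \<in> monomials Y" "keys m \<inter> Z = {}" "keys m' \<inter> Z = {}"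
      "edge_degree m = edge_degree m'" for m m'
    using that assms(2-) by (intro binomial_in_ideal[OF T, of "Y - Z"]) (auto simp: monomials_Diff)
qed

text \<open>
  Let \<open>m\<close> be the leading monomial of an element of the kernel. If \<open>m\<close> involves a variable of \<open>Z\<close>, that
  variable divides it. Otherwise its image is cancelled by a smaller monomial of the same degree, so
  \<open>m\<close> is divisible by the leading monomial of a quadratic binomial.
\<close>

lemma groebner_basis_edge_kernel:
  fixes X Z :: "'v set set"
  defines "G \<equiv> var ` Z \<union> quadratic_binomials (X - Z) :: ('v set, 'k::field) mpoly set"
  assumes xs: "set xs = X" and "Z \<subseteq> X" and rw: "quadratic_rewriting (X - Z)"
  shows "groebner_basis X (lex_order xs) (graded_kernel edge_degree X Z) G"
proof -
  let ?r = "lex_order xs"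
  let ?I = "graded_kernel edge_degree X Z :: ('v set, 'k) mpoly set"
  have finX: "finite X" using xs by auto
  then have fin: "finite G"
    using \<open>Z \<subseteq> X\<close> finite_quadratic_binomials[of "X - Z"] by (auto simp: G_def finite_subset)
  have "var z \<in> ?I" if "z \<in> Z" for z
    using that \<open>Z \<subseteq> X\<close> by (auto simp: graded_kernel_def var_def specialise_single monomials_def)
  moreover have "quadratic_binomials (X - Z) \<subseteq> ?I"
  proof
    fix g :: "('v set, 'k) mpoly" assume "g \<in> quadratic_binomials (X - Z)"
    then obtain q q' where "g = single q 1 - single q' 1" "q \<in> quadratic_monomials (X - Z)"
      "q' \<in> quadratic_monomials (X - Z)" "edge_degree q = edge_degree q'"
      by (auto simp: quadratic_binomials_def)
    moreover from this have "q \<in> monomials (X - Z)" "q' \<in> monomials (X - Z)"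
      using quadratic_monomials_subset by auto
    ultimately show "g \<in> ?I"
      by (auto simp: monomials_Diff intro!: binomial_in_graded_kernel)
  qed
  ultimately have GI: "G \<subseteq> ?I" by (auto simp: G_def)
  have "(0 :: ('v set, 'k) mpoly) \<notin> var ` Z" by (auto simp: var_def simp flip: keys_eq_empty)
  moreover have "(0 :: ('v set, 'k) mpoly) \<notin> quadratic_binomials (X - Z)"
  proof
    assume "(0 :: ('v set, 'k) mpoly) \<in> quadratic_binomials (X - Z)"
    then obtain q q' :: "'v set mono" where *: "single q (1 :: 'k) = single q' 1" "q \<noteq> q'"
      by (auto simp: quadratic_binomials_def)
    from arg_cong[OF *(1), of keys] *(2) show False by simp
  qed
  ultimately have 0: "0 \<notin> G" by (auto simp: G_def)
  have init_carrier: "initial_term ?r f \<in> carrier (poly_ring X)" if "f \<in> ?I" for f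
    using that lead_monomial_lex(1)[of f xs] xs
    by (auto simp: initial_term_def graded_kernel_def carrier_poly_ring monomials_def)
  let ?T = "Idl\<^bsub>poly_ring X\<^esub> (initial_term ?r ` G)"
  have T: "ideal ?T (poly_ring X)" using init_carrier GI by (intro ideal_Idl) auto
  have in_T: "initial_term ?r g \<in> ?T" if "g \<in> G" for g
    using that Idl_superset[of "initial_term ?r ` G" X] by auto
  have "initial_term ?r f \<in> ?T" if f: "f \<in> ?I" for f
  proof (cases "f = 0")
    case True
    then show ?thesis using ideal_poly_ringD(2)[OF T] by (simp add: initial_term_def)
  next
    case False
    let ?m = "lead_monomial ?r f"
    have fX: "f \<in> carrier (poly_ring (set xs))" using f xs by (simp add: graded_kernel_def)
    note lead = lead_monomial_lex[OF False fX]
    have mX: "keys f \<subseteq> monomials X" using fX xs by (simp add: carrier_poly_ring)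
    have "single ?m 1 \<in> ?T"
    proof (cases "keys ?m \<inter> Z = {}")
      case False
      have "var z \<in> ?T" if "z \<in> Z" for z
      proof -
        have "lead_monomial ?r (var z :: ('v set, 'k) mpoly) = single z 1"
          using that \<open>Z \<subseteq> X\<close> xs
          by (intro lead_monomial_lexI) (auto simp: var_def monomials_def)
        then have "initial_term ?r (var z :: ('v set, 'k) mpoly) = var z"
          by (auto simp: initial_term_def var_def simp flip: keys_eq_empty)
        then show ?thesis using in_T[of "var z"] that by (auto simp: G_def)
      qed
      then show ?thesis
        using lead(1) mX False by (intro monomial_in_ideal[OF T, of Z]) auto
    next
      case True
      obtain m' where m': "m' \<in> keys f" "m' \<noteq> ?m" "keys m' \<inter> Z = {}" "edge_degree m' = edge_degree ?m"
        using graded_kernel_partner[OF f lead(1) True] .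
      obtain q q' s where q: "q \<in> quadratic_monomials (X - Z)" "q' \<in> quadratic_monomials (X - Z)"
          "?m = q + s" "edge_degree q = edge_degree q'" "(q', q) \<in> lex_less xs"
      proof (rule quadratic_rewriting_step[OF rw, of xs ?m m'])
        show "?m \<in> monomials (X - Z)" "m' \<in> monomials (X - Z)"
          using lead(1) m' mX True by (auto simp: monomials_Diff)
      qed (use xs lead(2)[OF m'(1,2)] m'(4) in auto)
      have ne: "q \<noteq> q'" using q(5) by auto
      let ?g = "single q 1 - single q' 1 :: ('v set, 'k) mpoly"
      have g: "?g \<in> G" using quadratic_binomialsI[OF q(1,2,4) ne] unfolding G_def by blast
      have lk: "lookup ?g n = (if n = q then 1 else if n = q' then -1 else 0)" for n
        using ne by (auto simp: lookup_minus lookup_single when_def)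
      have keys_g: "keys ?g = {q, q'}" using ne by (auto simp: in_keys_iff lk split: if_splits)
      have "lead_monomial ?r ?g = q"
        using q(5) g GI xs by (intro lead_monomial_lexI) (auto simp: keys_g graded_kernel_def)
      then have "initial_term ?r ?g = single q 1"
        using g 0 by (auto simp: initial_term_def lk)
      then have "single q 1 \<in> ?T" using in_T[OF g] by simp
      then have "single s 1 * single q 1 \<in> ?T"
        using lead(1) mX q(3) by (intro ideal_poly_ringD(5)[OF T]) auto
      then show ?thesis by (simp add: q(3) mult_single add.commute)
    qed
    then have "single 0 (lookup f ?m) * single ?m 1 \<in> ?T"
      by (intro ideal_poly_ringD(5)[OF T]) (auto simp: monomials_def)
    then show ?thesis using False by (simp add: initial_term_def mult_single)
  qed
  then have "Idl\<^bsub>poly_ring X\<^esub> (initial_term ?r ` ?I) \<subseteq> ?T"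
    by (intro Idl_least[OF T]) auto
  moreover have "?T \<subseteq> Idl\<^bsub>poly_ring X\<^esub> (initial_term ?r ` ?I)"
    using init_carrier GI Idl_superset[of "initial_term ?r ` ?I" X]
    by (intro Idl_least ideal_Idl) auto
  ultimately show ?thesis using fin GI 0 by (auto simp: groebner_basis_def)
qed

section \<open>Exchange partners of an edge\<close>

text \<open>
  A power of a single edge is the only monomial of its degree: other edges with positive exponent
  would have to lie inside \<open>e\<close>, and in a simple graph the only edge inside \<open>e\<close> is \<open>e\<close>.
\<close>

lemma edge_degree_eq_single:
  assumes X: "\<forall>e\<in>X. card e = 2" and "m \<in> monomials X" "e \<in> X"
    and eq: "edge_degree m = edge_degree (single e k)"
  shows "m = single e k"
proof -
  have fin: "finite e'" if "e' \<in> X" for e' using X that card.infinite by fastforce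
  have lookup_deg: "lookup (edge_degree n) v = (\<Sum>e | e \<in> keys n \<and> v \<in> e. lookup n e)"
    if "n \<in> monomials X" for n v
  proof -
    have "lookup (edge_degree n) v = (\<Sum>e\<in>keys n. if v \<in> e then lookup n e else 0)"
      unfolding edge_degree_def lookup_sum using that fin
      by (intro sum.cong) (auto simp: lookup_single when_def monomials_def)
    also have "\<dots> = (\<Sum>e | e \<in> keys n \<and> v \<in> e. lookup n e)"
      by (simp add: sum.inter_filter)
    finally show ?thesis .
  qed
  have le: "lookup n f \<le> lookup (edge_degree n) v" if "n \<in> monomials X" "v \<in> f" for n f v
  proof (cases "f \<in> keys n")
    case True
    then show ?thesis unfolding lookup_deg[OF that(1)] using that(2)
      by (intro member_le_sum) auto
  qed (simp add: in_keys_iff)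
  have eX: "single e k \<in> monomials X" using assms(3) by (simp add: monomials_def)
  have "f = e" if f: "f \<in> keys m" for f
  proof -
    have fX: "f \<in> X" using f assms(2) by (auto simp: monomials_def)
    have "f \<subseteq> e"
    proof
      fix v assume "v \<in> f"
      then have "0 < lookup (edge_degree (single e k)) v"
        using le[OF assms(2), of v f] f eq by (simp add: in_keys_iff)
      moreover have "{f. f \<in> keys (single e k) \<and> v \<in> f} = {}" if "v \<notin> e" using that by auto
      ultimately show "v \<in> e" unfolding lookup_deg[OF eX] by (metis less_irrefl sum.empty)
    qed
    then show "f = e" using X fX assms(3) fin[OF assms(3)] by (simp add: card_subset_eq)
  qed
  then have "keys m \<subseteq> {e}" by auto
  then have m: "m = single e (lookup m e)"
    by (intro poly_mapping_eqI) (metis in_keys_iff lookup_single_eq lookup_single_not_eq singletonD subsetD)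
  obtain v where v: "v \<in> e" using X assms(3) by fastforce
  have "lookup (edge_degree (single e i)) v = i" for i
    using v fin[OF assms(3)] unfolding edge_degree_single lookup_sum
    by (simp add: lookup_single when_def)
  then have "lookup m e = k" using eq m by metis
  with m show ?thesis by simp
qed

text \<open>
  The variables \<open>z\<close> for which \<open>y z - q\<close> is a nontrivial binomial of the toric ideal. They
  are, up to sign, the leading coefficients, with respect to \<open>y\<close>, of the quadratic binomials in which \<open>y\<close> occurs.
\<close>

definition exchange_partners :: "'v set set \<Rightarrow> 'v set \<Rightarrow> 'v set set" where
  "exchange_partners X y = {z \<in> X. \<exists>q\<in>quadratic_monomials X.
     q \<noteq> single y 1 + single z 1 \<and> edge_degree q = edge_degree (single y 1 + single z 1)}"

lemma self_not_exchange_partner: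
  assumes X: "\<forall>e\<in>X. card e = 2" and "y \<in> X"
  shows "y \<notin> exchange_partners X y"
proof
  assume "y \<in> exchange_partners X y"
  then obtain q where q: "q \<in> quadratic_monomials X" "q \<noteq> single y 1 + single y 1"
      "edge_degree q = edge_degree (single y 1 + single y 1)"
    by (auto simp: exchange_partners_def)
  have "q = single y 2"
    by (rule edge_degree_eq_single[of X]) (use q assms quadratic_monomials_subset in
        \<open>auto simp flip: single_add simp: numeral_2_eq_2\<close>)
  with q(2) show False by (simp flip: single_add add: numeral_2_eq_2)
qed

text \<open>
  If \<open>y\<close> occurred on both sides it could be cancelled, and a single edge is determined by its degree.
\<close>

lemma exchange_avoids:
  assumes X: "\<forall>e\<in>X. card e = 2" and "z \<in> X"
    and q: "q \<in> quadratic_monomials X" "q \<noteq> single y 1 + single z 1"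
      "edge_degree q = edge_degree (single y 1 + single z 1)"
  shows "lookup q y = 0"
proof (rule ccontr)
  assume "lookup q y \<noteq> 0"
  then obtain b where b: "b \<in> X" "q = single y 1 + single b 1"
    using q(1) by (auto simp: quadratic_monomials_def lookup_add lookup_single when_def
        add.commute split: if_splits)
  then have "edge_degree (single b 1) = edge_degree (single z 1)"
    using q(3) by (simp add: edge_degree_add)
  then have "single b 1 = (single z 1 :: 'a set mono)"
    using b(1) \<open>z \<in> X\<close> by (intro edge_degree_eq_single[OF X]) (auto simp: monomials_def)
  then show False using b(2) q(2) by simp
qed

lemma exchange_partnerE:
  assumes X: "\<forall>e\<in>X. card e = 2" and "z \<in> exchange_partners X y"
  obtains q where "q \<in> quadratic_monomials X" "q \<noteq> single y 1 + single z 1" "lookup q y = 0"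
    "edge_degree q = edge_degree (single y 1 + single z 1)"
  using exchange_avoids[OF X] assms(2) that by (auto simp: exchange_partners_def)

text \<open>
  The combinatorial heart of the proof. Suppose \<open>y\<^sup>j n\<close> had the same degree as a monomial with a smaller
  power of \<open>y\<close>. In the lexicographic order with \<open>y\<close> first and the exchange partners next,
  replace \<open>n\<close> by the least monomial \<open>l\<close> of its degree, which still avoids \<open>y\<close> and the partners.
  Now \<open>y\<^sup>j l\<close> is not least of its degree, so a quadratic monomial \<open>q\<close> dividing it is not least
  either. But \<open>q\<close> is not \<open>y\<^sup>2\<close>, which is alone in its degree; \<open>q\<close> is not \<open>y x\<close>, as \<open>x\<close> would be a
  partner dividing \<open>l\<close>; and \<open>q\<close> does not divide \<open>l\<close>, as \<open>l\<close> is least.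
\<close>

lemma degree_drop_impossible:
  assumes X: "\<forall>e\<in>X. card e = 2" "finite X" "quadratic_rewriting X" "y \<in> X"
    and n: "n \<in> monomials X" "lookup n y = 0" "keys n \<inter> exchange_partners X y = {}"
    and m: "m \<in> monomials X" "lookup m y < j"
  shows "edge_degree m \<noteq> edge_degree (single y j + n)"
proof
  assume eq: "edge_degree m = edge_degree (single y j + n)"
  let ?Z = "exchange_partners X y"
  have Z: "?Z \<subseteq> X" by (auto simp: exchange_partners_def)
  obtain zs where zs: "set zs = ?Z" using finite_list[OF finite_subset[OF Z X(2)]] by auto
  obtain rest where rest: "set rest = X" using finite_list[OF X(2)] by auto
  \<comment> \<open>y first, then the partners; the repetitions in rest are harmless.\<close>
  define xs where "xs = (y # zs) @ rest"
  have xs: "set xs = X" using zs rest Z X(4) by (auto simp: xs_def)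
  let ?S = "{n' \<in> monomials X. edge_degree n' = edge_degree n \<and> (n' = n \<or> (n', n) \<in> lex_less xs)}"
  have "n \<in> ?S" using n by simp
  then obtain l where l: "l \<in> ?S" "\<And>l'. (l', l) \<in> lex_less xs \<Longrightarrow> l' \<notin> ?S"
    using wf_lex_less[of xs] by (metis (no_types, lifting) wfE_min)
  have n_avoid: "keys n \<inter> set (y # zs) = {}" using n zs by (auto simp: in_keys_iff)
  have "keys l \<inter> set (y # zs) = {}"
    using l(1) n_avoid lex_less_append_avoiding(1)[of l n "y # zs" rest] by (auto simp: xs_def)
  then have ly: "lookup l y = 0" and lZ: "keys l \<inter> ?Z = {}"
    using zs by (auto simp: in_keys_iff)
  have minimal: "(l', l) \<notin> lex_less xs" if "l' \<in> monomials X" "edge_degree l' = edge_degree l" for l'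
    using l that by (auto intro: lex_less_trans)
  have "(m, single y j + l) \<in> lex_less xs"
    using m(2) ly by (simp add: xs_def mlex_iff lookup_add)
  moreover have "edge_degree (single y j + l) = edge_degree m"
    using eq l(1) by (simp add: edge_degree_add)
  moreover have "single y j + l \<in> monomials X"
    using X(4) l(1) by (subst monomials_add_iff) (auto simp: monomials_def)
  ultimately obtain q q' s where q: "q \<in> quadratic_monomials X" "q' \<in> quadratic_monomials X"
      "single y j + l = q + s" "edge_degree q = edge_degree q'" "(q', q) \<in> lex_less xs"
    using quadratic_rewriting_step[OF X(3), of xs "single y j + l" m] m(1) xs by auto
  obtain a b where ab: "a \<in> X" "b \<in> X" "q = single a 1 + single b 1"
    using q(1) by (auto simp: quadratic_monomials_def)
  have lookups: "(if y = x then j else 0) + lookup l x = lookup q x + lookup s x" for x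
    using arg_cong[OF q(3), of "\<lambda>t. lookup t x"] by (simp add: lookup_add lookup_single when_def)
  have partner: "x \<in> ?Z" if "q = single y 1 + single x 1" "x \<in> X" for x
    using that q(2,4,5) by (auto simp: exchange_partners_def intro!: bexI[of _ q'])
  have no_partner: False if "q = single y 1 + single x 1" "x \<in> X" for x
  proof -
    have "x \<noteq> y" using partner[OF that] self_not_exchange_partner[OF X(1) X(4)] by auto
    then have "x \<in> keys l" using lookups[of x] that(1)
      by (auto simp: in_keys_iff lookup_add lookup_single when_def)
    with partner[OF that] lZ show False by blast
  qed
  have "a \<noteq> y" "b \<noteq> y" using no_partner[of b] no_partner[of a] ab by (auto simp: add.commute)
  then have qy: "lookup q y = 0" by (simp add: ab(3) lookup_add lookup_single when_def)
  \<comment> \<open>Since q avoids y, the whole power of y sits in s.\<close>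
  define s' where "s' = s - single y j"
  have "l = q + s'"
  proof (rule poly_mapping_eqI)
    fix x show "lookup l x = lookup (q + s') x"
      using lookups[of x] qy ly
      by (cases "x = y") (simp_all add: s'_def lookup_add lookup_minus lookup_single_not_eq)
  qed
  moreover from this have "s' \<in> monomials X" using l(1) by auto
  ultimately have "q' + s' \<in> monomials X" "edge_degree (q' + s') = edge_degree l"
      "(q' + s', l) \<in> lex_less xs"
    using q quadratic_monomials_subset by (auto simp: edge_degree_add)
  with minimal show False by blast
qed

section \<open>The decomposition of the initial ideal\<close>

lemma init_in_closed:
  "f \<in> carrier (poly_ring X) \<Longrightarrow> init_in y f \<in> carrier (poly_ring X)"
  by (auto simp: carrier_poly_ring keys_init_in)

lemma lead_coeff_in_closed:
  assumes "f \<in> carrier (poly_ring X)"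
  shows "lead_coeff_in y f \<in> carrier (poly_ring (X - {y}))"
  unfolding carrier_poly_ring
proof
  fix m assume m: "m \<in> keys (lead_coeff_in y f)"
  then have "lookup m y = 0" "m + single y (deg_in y f) \<in> keys f"
    by (auto simp: lead_coeff_in_def lookup_coeff_in in_keys_iff split: if_splits)
  moreover from this have "m + single y (deg_in y f) \<in> monomials X"
    using assms unfolding carrier_poly_ring by blast
  ultimately show "m \<in> monomials (X - {y})"
    by (auto simp: monomials_Diff in_keys_iff)
qed

lemma deg_in_0:
  assumes "deg_in y f = 0"
  shows "lead_coeff_in y f = f" "init_in y f = f"
proof -
  have "lookup m y = 0" if "m \<in> keys f" for m using deg_in_ge[OF that, of y] assms by simp
  then show "lead_coeff_in y f = f"
    by (intro poly_mapping_eqI)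
      (metis add.right_neutral assms in_keys_iff lead_coeff_in_def lookup_coeff_in single_zero)
  then show "init_in y f = f" by (simp add: init_in_def assms)
qed

lemma Idl_var:
  assumes "y \<in> X"
  shows "Idl\<^bsub>poly_ring X\<^esub> {var y} =
    {k * var y | k. k \<in> carrier (poly_ring X :: ('x, 'k::field) mpoly ring)}"
proof -
  interpret cring "poly_ring X :: ('x, 'k) mpoly ring" by (rule cring_poly_ring)
  have "(var y :: ('x, 'k) mpoly) \<in> carrier (poly_ring X)"
    using assms by (simp add: var_def monomials_def)
  from cgenideal_eq_genideal[OF this] show ?thesis by (simp add: cgenideal_def)
qed

text \<open>
  Abstract form of the identity \<open>in\<^sub>y(I) = C \<inter> (N + \<langle>y\<rangle>)\<close> for a set \<open>G\<close> that is linear in \<open>y\<close>. For the inclusion from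
  left to right, an initial form without \<open>y\<close> is an element of \<open>I\<close> without \<open>y\<close> and so lies in \<open>N\<close>, and one with \<open>y\<close> is a multiple of \<open>y\<close>
  and lies in \<open>C\<close> by hypothesis. For the converse, an element \<open>n + k y\<close> of the right-hand side has
  \<open>k y \<in> C\<close> because \<open>N \<subseteq> C\<close>, hence \<open>k \<in> C\<close>; and \<open>y C\<close> is contained in the initial ideal since
  \<open>y\<close> times a leading coefficient is an initial form or a multiple of one.
\<close>

lemma init_ideal_in_eq:
  fixes I G :: "('x, 'k::field) mpoly set" and X :: "'x set" and y :: 'x
  defines "C \<equiv> C_ideal X y G" and "N \<equiv> N_ideal X y G"
  assumes I: "ideal I (poly_ring X)" and GI: "G \<subseteq> I" and y: "y \<in> X"
    and deg: "\<And>g. g \<in> G \<Longrightarrow> deg_in y g \<le> 1"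
    and top: "\<And>f. f \<in> I \<Longrightarrow> deg_in y f \<noteq> 0 \<Longrightarrow> init_in y f \<in> C"
    and cancel: "\<And>k. k \<in> carrier (poly_ring X) \<Longrightarrow> k * var y \<in> C \<Longrightarrow> k \<in> C"
    and free: "I \<inter> carrier (poly_ring (X - {y})) \<subseteq> N"
  shows "init_ideal_in X y I = C \<inter> (N <+>\<^bsub>poly_ring X\<^esub> Idl\<^bsub>poly_ring X\<^esub> {var y})"
proof -
  interpret R: cring "poly_ring X :: ('x, 'k) mpoly ring" by (rule cring_poly_ring)
  let ?C = "C" and ?N = "N" and ?Y = "Idl\<^bsub>poly_ring X\<^esub> {var y} :: ('x, 'k) mpoly set"
  let ?in = "init_ideal_in X y I"
  have yX: "(var y :: ('x, 'k) mpoly) \<in> carrier (poly_ring X)"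
    using y by (simp add: var_def monomials_def)
  have IX: "I \<subseteq> carrier (poly_ring X)" by (rule ideal_poly_ringD[OF I])
  have lcX: "lead_coeff_in y f \<in> carrier (poly_ring X)" if "f \<in> I" for f
    using lead_coeff_in_closed[of f X y] that IX poly_ring_mono[of "X - {y}" X] by blast
  have C: "ideal ?C (poly_ring X)" and N: "ideal ?N (poly_ring X)" and in': "ideal ?in (poly_ring X)"
    unfolding C_def N_def C_ideal_def N_ideal_def init_ideal_in_def
    using GI lcX init_in_closed[of _ X y] IX by (intro ideal_Idl; blast)+
  have Y: "ideal ?Y (poly_ring X)" using yX by (intro ideal_Idl) auto
  have NC: "?N \<subseteq> ?C"
    unfolding N_def N_ideal_def
  proof (rule Idl_least[OF C])
    have "lead_coeff_in y ` G \<subseteq> ?C" unfolding C_def C_ideal_def by (rule Idl_superset)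
    then show "lead_coeff_in y ` {g \<in> G. deg_in y g = 0} \<subseteq> ?C" by blast
  qed
  have sum: "h \<in> ?N <+>\<^bsub>poly_ring X\<^esub> ?Y \<longleftrightarrow> (\<exists>n\<in>?N. \<exists>k\<in>carrier (poly_ring X). h = n + k * var y)" for h
    using y by (auto simp: set_add_def' Idl_var)
  have in_I: "init_in y f \<in> ?in" if "f \<in> I" for f
    using that Idl_superset[of "init_in y ` I" X] by (auto simp: init_ideal_in_def)
  show ?thesis
  proof
    have "ideal (?C \<inter> (?N <+>\<^bsub>poly_ring X\<^esub> ?Y)) (poly_ring X)"
      by (intro R.i_intersect C R.add_ideals N Y)
    moreover have "init_in y f \<in> ?C \<inter> (?N <+>\<^bsub>poly_ring X\<^esub> ?Y)" if f: "f \<in> I" for f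
    proof (cases "deg_in y f = 0")
      case True
      have "keys f \<subseteq> monomials (X - {y})"
      proof
        fix m assume m: "m \<in> keys f"
        then have "m \<in> monomials X" using f IX carrier_poly_ring by blast
        moreover have "lookup m y = 0" using deg_in_ge[OF m, of y] True by simp
        ultimately show "m \<in> monomials (X - {y})" by (simp add: monomials_Diff in_keys_iff)
      qed
      then have "f \<in> ?N" using f free by (auto simp: carrier_poly_ring)
      moreover have "\<exists>k\<in>carrier (poly_ring X). f = f + k * var y"
        using R.zero_closed by (intro bexI[of _ 0]) auto
      ultimately show ?thesis
        using NC unfolding Int_iff sum deg_in_0(2)[OF True] by blast
    next
      case False
      have "init_in y f = 0 + (lead_coeff_in y f * var y ^ (deg_in y f - 1)) * var y"
        using False by (simp add: init_in_def mult.assoc flip: power_Suc2)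
      moreover have "lead_coeff_in y f * var y ^ (deg_in y f - 1) \<in> carrier (poly_ring X)"
        using lcX[OF f] y by (intro poly_ring_closed) (auto simp: var_power monomials_def)
      ultimately show ?thesis
        using top[OF f False] ideal_poly_ringD(2)[OF N] unfolding Int_iff sum by blast
    qed
    ultimately show "?in \<subseteq> ?C \<inter> (?N <+>\<^bsub>poly_ring X\<^esub> ?Y)"
      unfolding init_ideal_in_def by (intro Idl_least) auto
  next
    have N_in: "?N \<subseteq> ?in"
      unfolding N_def N_ideal_def
    proof (intro Idl_least in', safe)
      fix g assume "g \<in> G" "deg_in y g = 0"
      then show "lead_coeff_in y g \<in> ?in" using in_I[of g] GI by (auto simp: deg_in_0)
    qed
    \<comment> \<open>The quotient of the initial ideal by y contains C because it contains the generators of C.\<close>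
    let ?M = "{k \<in> carrier (poly_ring X). k * var y \<in> ?in}"
    have "ideal ?M (poly_ring X)"
      using ideal_poly_ringD[OF in'] poly_ring_closed[of _ X] R.zero_closed
      by (intro ideal_poly_ringI) (auto simp: distrib_right mult.assoc)
    moreover have "lead_coeff_in y g \<in> ?M" if g: "g \<in> G" for g
    proof -
      consider "deg_in y g = 0" | "deg_in y g = 1" using deg[OF g] by linarith
      then have "lead_coeff_in y g * var y \<in> ?in"
      proof cases
        case 1
        then show ?thesis
          using in_I[of g] g GI ideal_poly_ringD(5)[OF in' _ yX, of g] by (auto simp: deg_in_0 mult.commute)
      next
        case 2
        then show ?thesis using in_I[of g] g GI by (auto simp: init_in_def)
      qed
      then show ?thesis using lcX g GI by blast
    qed
    ultimately have CM: "?C \<subseteq> ?M" unfolding C_def C_ideal_def by (intro Idl_least) auto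
    show "?C \<inter> (?N <+>\<^bsub>poly_ring X\<^esub> ?Y) \<subseteq> ?in"
    proof
      fix h assume h: "h \<in> ?C \<inter> (?N <+>\<^bsub>poly_ring X\<^esub> ?Y)"
      then obtain n k where nk: "n \<in> ?N" "k \<in> carrier (poly_ring X)" "h = n + k * var y"
        using sum by blast
      have "h - n \<in> ?C" using h nk(1) NC by (intro ideal_poly_ringD(4)[OF C]) auto
      then have "k \<in> ?C" using cancel[OF nk(2)] nk(3) by simp
      then have "k * var y \<in> ?in" using CM by auto
      then show "h \<in> ?in" using nk N_in ideal_poly_ringD(3)[OF in'] by auto
    qed
  qed
qed

section \<open>A grading that sets one variable apart\<close>

text \<open>
  Recording the degree in \<open>y\<close> separately makes \<open>y\<close> independent of the other variables. For \<open>y \<notin> Z\<close>, a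
  polynomial is in the kernel for this grading iff all its coefficients with respect to \<open>y\<close> are in the kernel
  for \<^const>\<open>edge_degree\<close>; so the kernel is extended from the ring without \<open>y\<close>, and \<open>y\<close> can be
  cancelled in it.
\<close>

definition bidegree :: "'v set \<Rightarrow> 'v set mono \<Rightarrow> nat \<times> 'v mono" where
  "bidegree y m = (lookup m y, edge_degree m)"

lemma bidegree_add: "bidegree y (m + n) = bidegree y m + bidegree y n"
  by (simp add: bidegree_def lookup_add edge_degree_add)

lemma bidegree_kernel_contraction:
  "graded_kernel (bidegree y) X Z \<inter> carrier (poly_ring (X - {y})) = graded_kernel edge_degree (X - {y}) Z"
proof -
  have "specialise (bidegree y) Z p = 0 \<longleftrightarrow> specialise edge_degree Z p = 0"
    if p: "p \<in> carrier (poly_ring (X - {y}))" for p :: "('a set, 'b::field) mpoly"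
  proof -
    have y: "lookup m y = 0" if "m \<in> keys p" for m
      using that p by (auto simp: carrier_poly_ring monomials_Diff in_keys_iff subset_iff)
    then have "{m. m \<in> keys p \<and> keys m \<inter> Z = {} \<and> bidegree y m = (j, c)} =
        (if j = 0 then {m. m \<in> keys p \<and> keys m \<inter> Z = {} \<and> edge_degree m = c} else {})" for j c
      by (auto simp: bidegree_def)
    then have "lookup (specialise (bidegree y) Z p) (j, c) =
        (if j = 0 then lookup (specialise edge_degree Z p) c else 0)" for j c
      unfolding lookup_specialise by simp
    then show ?thesis by (auto simp: poly_mapping_eq_iff fun_eq_iff)
  qed
  then show ?thesis
    using poly_ring_mono[of "X - {y}" X] by (auto simp: graded_kernel_def)
qed

text \<open>
  Multiplication by a monomial shifts the exponents injectively.
\<close>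

lemma single_times_eq_0:
  fixes P :: "'m::cancel_comm_monoid_add \<Rightarrow>\<^sub>0 'k::field"
  assumes "P * single a 1 = 0"
  shows "P = 0"
proof (rule poly_mapping_eqI)
  fix c
  have "P * single a 1 = (\<Sum>d\<in>keys P. single (d + a) (lookup P d))"
    by (subst poly_eq_sum_single[of P]) (simp add: sum_distrib_right mult_single)
  then have "lookup (P * single a 1) (c + a) =
      (\<Sum>d\<in>keys P. lookup (single (d + a) (lookup P d)) (c + a))"
    by (simp only: lookup_sum)
  also have "\<dots> = (\<Sum>d\<in>keys P. if d = c then lookup P d else 0)"
    by (rule sum.cong) (auto simp: lookup_single when_def)
  finally have "lookup (P * single a 1) (c + a) = (\<Sum>d\<in>keys P. if d = c then lookup P d else 0)" .
  then show "lookup P c = lookup 0 c" using assms by (simp add: in_keys_iff split: if_splits)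
qed

lemma bidegree_kernel_cancel:
  assumes "y \<notin> Z" "k \<in> carrier (poly_ring X)" "k * var y \<in> graded_kernel (bidegree y) X Z"
  shows "k \<in> graded_kernel (bidegree y) X Z"
proof -
  have "specialise (bidegree y) Z k * specialise (bidegree y) Z (var y) = 0"
    using assms(3) by (simp add: graded_kernel_def specialise_mult[OF bidegree_add])
  then have "specialise (bidegree y) Z k = 0"
    using assms(1) single_times_eq_0 by (auto simp: var_def specialise_single)
  then show ?thesis using assms(2) by (simp add: graded_kernel_def)
qed

section \<open>The ideals C and N of an edge\<close>

text \<open>
  With all variables sent to 0 no binomial is left among the generators of the kernel.
\<close>

lemma Idl_variables_eq_kernel:
  fixes X :: "'v set set"
  assumes "finite X" "quadratic_rewriting ({} :: 'v set set)"
  shows "Idl\<^bsub>poly_ring X\<^esub> (var ` X) = (graded_kernel edge_degree X X :: ('v set, 'k::field) mpoly set)"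
    (is "?T = ?I")
proof
  have X: "(var ` X :: ('v set, 'k) mpoly set) \<subseteq> ?I"
    by (auto simp: graded_kernel_def var_def specialise_single monomials_def)
  then show "?T \<subseteq> ?I" by (intro Idl_least ideal_graded_kernel edge_degree_add)
  have T: "ideal ?T (poly_ring X)" using X by (intro ideal_Idl) (auto simp: graded_kernel_def)
  show "?I \<subseteq> ?T"
    using assms Idl_superset[of "var ` X" X]
    by (intro edge_kernel_subset_ideal[OF T])
      (auto simp: quadratic_binomials_def quadratic_monomials_def)
qed

lemma keys_binomial: "q \<noteq> q' \<Longrightarrow> keys (single q 1 - single q' (1 :: 'k::field)) = {q, q'}"
  by (auto simp: in_keys_iff lookup_minus lookup_single when_def split: if_splits)


lemma kernel_deletion:
  fixes A :: "'x mono \<Rightarrow> 'm::comm_monoid_add"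
  shows "(graded_kernel A X Z :: ('x, 'k::field) mpoly set) \<inter> carrier (poly_ring (X - {y})) =
    graded_kernel A (X - {y}) (Z - {y})"
proof -
  have "specialise A Z p = specialise A (Z - {y}) p" if "p \<in> carrier (poly_ring (X - {y}))"
    for p :: "('x, 'k) mpoly"
  proof -
    have "y \<notin> keys m" if "m \<in> keys p" for m
      using that \<open>p \<in> _\<close> unfolding carrier_poly_ring monomials_def by blast
    then have "{m. m \<in> keys p \<and> keys m \<inter> Z = {}} = {m. m \<in> keys p \<and> keys m \<inter> (Z - {y}) = {}}"
      by blast
    then show ?thesis by (simp add: specialise_def)
  qed
  then show ?thesis using poly_ring_mono[of "X - {y}" X] by (auto simp: graded_kernel_def)
qed

text \<open>
  The ideal \<open>N\<close> belongs to the deletion of \<open>y\<close>. Elements of \<open>N\<close> lie in \<open>I\<close>, and the elements of \<open>I\<close>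
  without \<open>y\<close> form the kernel of the graph without \<open>y\<close>, which is generated by the members of \<open>G\<close>
  that do not involve \<open>y\<close>.
\<close>

lemma N_ideal_contraction:
  fixes X Z :: "'v set set"
  defines "G \<equiv> var ` Z \<union> quadratic_binomials (X - Z) :: ('v set, 'k::field) mpoly set"
  assumes fin: "finite X" and "Z \<subseteq> X" and rw: "quadratic_rewriting (X - Z)"
    and GI: "G \<subseteq> graded_kernel edge_degree X Z" and 0: "0 \<notin> G"
  shows "N_ideal X y G \<inter> carrier (poly_ring (X - {y})) = graded_kernel edge_degree (X - {y}) (Z - {y})"
    and "graded_kernel edge_degree (X - {y}) (Z - {y}) \<subseteq> N_ideal X y G"
proof -
  let ?I = "graded_kernel edge_degree X Z :: ('v set, 'k) mpoly set"
  let ?N = "N_ideal X y G"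
  let ?S = "lead_coeff_in y ` {g \<in> G. deg_in y g = 0}"
  have SI: "?S \<subseteq> ?I" using GI by (auto simp: deg_in_0)
  have NI: "?N \<subseteq> ?I"
    unfolding N_ideal_def by (intro Idl_least ideal_graded_kernel edge_degree_add SI)
  have N: "ideal ?N (poly_ring X)"
    unfolding N_ideal_def using SI by (intro ideal_Idl) (auto simp: graded_kernel_def)
  have GN: "G \<inter> carrier (poly_ring (X - {y})) \<subseteq> ?N"
  proof
    fix g assume g: "g \<in> G \<inter> carrier (poly_ring (X - {y}))"
    with 0 have "g \<noteq> 0" by auto
    then obtain m where "m \<in> keys g" "lookup m y = deg_in y g" by (rule deg_in_attained)
    moreover from this g have "lookup m y = 0"
      by (auto simp: carrier_poly_ring monomials_Diff in_keys_iff subset_iff)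
    ultimately have deg: "deg_in y g = 0" by simp
    then have "g \<in> ?S" using g deg_in_0(1)[OF deg] by force
    then show "g \<in> ?N" using Idl_superset[of ?S X] by (auto simp: N_ideal_def)
  qed
  have sub: "X - {y} - (Z - {y}) \<subseteq> X - Z" by auto
  show sup: "graded_kernel edge_degree (X - {y}) (Z - {y}) \<subseteq> ?N"
  proof (rule edge_kernel_subset_ideal[OF N])
    show "quadratic_rewriting (X - {y} - (Z - {y}))"
      using quadratic_rewriting_subset[OF rw _ sub] fin by simp
    have "var z \<in> carrier (poly_ring (X - {y}) :: ('v set, 'k) mpoly ring)" if "z \<in> Z - {y}" for z
      using that \<open>Z \<subseteq> X\<close> by (auto simp: var_def monomials_def)
    then have "(var ` (Z - {y}) :: ('v set, 'k) mpoly set) \<subseteq> G \<inter> carrier (poly_ring (X - {y}))"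
      by (auto simp: G_def)
    then show "var ` (Z - {y}) \<subseteq> ?N" using GN by blast
    have "(quadratic_binomials (X - {y} - (Z - {y})) :: ('v set, 'k) mpoly set) \<subseteq> carrier (poly_ring (X - {y}))"
    proof
      fix g :: "('v set, 'k) mpoly" assume "g \<in> quadratic_binomials (X - {y} - (Z - {y}))"
      then obtain q q' where "g = single q 1 - single q' 1"
          "q \<in> monomials (X - {y} - (Z - {y}))" "q' \<in> monomials (X - {y} - (Z - {y}))"
        using quadratic_monomials_subset unfolding quadratic_binomials_def by blast
      then show "g \<in> carrier (poly_ring (X - {y}))"
        by (simp add: monomials_Diff poly_ring_closed(4))
    qed
    then show "quadratic_binomials (X - {y} - (Z - {y})) \<subseteq> ?N"
      using GN quadratic_binomials_mono[OF sub] unfolding G_def by blast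
  qed (use fin in auto)
  show "?N \<inter> carrier (poly_ring (X - {y})) = graded_kernel edge_degree (X - {y}) (Z - {y})"
    using sup NI kernel_deletion[of edge_degree X Z y] by (auto simp: graded_kernel_def)
qed

lemma exchange_binomial_cases:
  assumes X: "\<forall>e\<in>X. card e = 2" and "y \<in> X"
    and q: "q \<in> quadratic_monomials X" "q' \<in> quadratic_monomials X" "edge_degree q = edge_degree q'" "q \<noteq> q'"
  obtains "lookup q y = 0" "lookup q' y = 0"
  | z where "z \<in> exchange_partners X y" "q = single y 1 + single z 1" "lookup q' y = 0"
  | z where "z \<in> exchange_partners X y" "q' = single y 1 + single z 1" "lookup q y = 0"
proof -
  have *: "\<exists>z\<in>exchange_partners X y. p = single y 1 + single z 1 \<and> lookup p' y = 0"
    if p: "p \<in> quadratic_monomials X" "p' \<in> quadratic_monomials X" "edge_degree p = edge_degree p'" "p \<noteq> p'"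
      "lookup p y \<noteq> 0" for p p'
  proof -
    obtain z where z: "z \<in> X" "p = single y 1 + single z 1"
      using p(1,5) by (auto simp: quadratic_monomials_def lookup_add lookup_single when_def
          add.commute split: if_splits)
    have "z \<in> exchange_partners X y"
      unfolding exchange_partners_def using z p by (auto intro!: bexI[of _ p'])
    moreover have "lookup p' y = 0"
      using p z by (intro exchange_avoids[OF X z(1)]) auto
    ultimately show ?thesis using z(2) by blast
  qed
  show ?thesis
    using *[OF q] *[OF q(2,1) q(3)[symmetric] q(4)[symmetric]] that by blast
qed

text \<open>The factor \<open>c\<close> covers both signs with which the exchange of \<open>y z\<close> for \<open>q\<close> occurs in a quadratic binomial.\<close>

lemma lead_coeff_exchange:
  fixes c :: "'k::field"
  assumes "z \<noteq> y" "lookup q y = 0" "c \<noteq> 0"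
  defines "g \<equiv> single (single y 1 + single z 1) c - single q c"
  shows "deg_in y g = 1" "lead_coeff_in y g = single (single z 1) c"
proof -
  let ?p = "single y 1 + single z 1 :: 'a mono"
  have p1: "lookup ?p y = 1" using assms(1) by (simp add: lookup_add lookup_single when_def)
  then have ne: "?p \<noteq> q" using assms(2) by auto
  have lk: "lookup g n = (if n = ?p then c else if n = q then - c else 0)" for n
    using ne by (auto simp: g_def lookup_minus lookup_single when_def)
  then have keys: "keys g = {?p, q}" using \<open>c \<noteq> 0\<close> by (auto simp: in_keys_iff split: if_splits)
  show deg: "deg_in y g = 1"
    using p1 assms(2) by (intro deg_inI[of ?p]) (auto simp: keys)
  show "lead_coeff_in y g = single (single z 1) c"
  proof (rule poly_mapping_eqI)
    fix m :: "'a mono"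
    have "m + single y 1 \<noteq> q" using assms(2) by (auto simp: lookup_add)
    moreover have "m + single y 1 = ?p \<longleftrightarrow> m = single z 1" by (metis add.commute add_left_cancel)
    moreover have "lookup (single z 1) y = (0 :: nat)" using assms(1) by (simp add: lookup_single)
    ultimately show "lookup (lead_coeff_in y g) m = lookup (single (single z 1) c) m"
      unfolding lead_coeff_in_def deg lookup_coeff_in lk by (auto simp: lookup_single when_def)
  qed
qed

text \<open>
  Replacing \<open>y z\<close> by \<open>q\<close> in \<open>y m\<close> lowers the degree in \<open>y\<close>, which \<open>degree_drop_impossible\<close> forbids
  for \<open>y n\<close> if \<open>n\<close> avoids the partners.
\<close>

lemma exchange_partners_saturated:
  assumes X: "\<forall>e\<in>X. card e = 2" "finite X" "quadratic_rewriting X" "y \<in> X"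
    and m: "m \<in> monomials X" "z \<in> keys m" "z \<in> exchange_partners X y"
    and n: "n \<in> monomials X" "lookup n y = 0" "edge_degree m = edge_degree n" "lookup m y = 0"
  shows "keys n \<inter> exchange_partners X y \<noteq> {}"
proof
  assume avoid: "keys n \<inter> exchange_partners X y = {}"
  obtain p where p: "p \<in> quadratic_monomials X" "lookup p y = 0"
      "edge_degree p = edge_degree (single y 1 + single z 1)"
    using exchange_partnerE[OF X(1) m(3)] .
  let ?s = "m - single z 1"
  have ms: "m = ?s + single z 1" by (rule split_off_variable[OF m(2)])
  have "p + ?s \<in> monomials X" using m(1) ms p(1) quadratic_monomials_subset by (metis monomials_add_iff subsetD)
  moreover have "lookup (p + ?s) y < 1" using p(2) n(4) by (simp add: lookup_add lookup_minus)
  moreover have "edge_degree (p + ?s) = edge_degree (single y 1 + (?s + single z 1))"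
    using p(3) by (simp add: edge_degree_add ac_simps)
  then have "edge_degree (p + ?s) = edge_degree (single y 1 + n)"
    using n(3) by (simp only: edge_degree_add ms[symmetric] flip: edge_degree_add[of ?s])
  ultimately show False using degree_drop_impossible[OF X n(1,2) avoid, of "p + ?s" 1] by blast
qed

text \<open>
  A quadratic binomial with \<open>y\<close> has an exchange partner as leading coefficient; one without \<open>y\<close> has
  both terms killed or both terms surviving, by \<open>exchange_partners_saturated\<close>. This places \<open>C\<close> in the
  kernel. Conversely \<open>C\<close> contains all partners and all quadratic binomials without \<open>y\<close>, and these
  generate the kernel: monomials of equal bidegree share the same power of \<open>y\<close>.
\<close>

lemma C_ideal_eq_bidegree_kernel:
  fixes X :: "'v set set"
  assumes X: "\<forall>e\<in>X. card e = 2" "finite X" "quadratic_rewriting X" "y \<in> X"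
  shows "C_ideal X y (quadratic_binomials X) =
    (graded_kernel (bidegree y) X (exchange_partners X y) :: ('v set, 'k::field) mpoly set)"
    (is "?C = ?K")
proof
  let ?W = "exchange_partners X y"
  let ?G = "quadratic_binomials X :: ('v set, 'k) mpoly set"
  have W: "?W \<subseteq> X" by (auto simp: exchange_partners_def)
  have yW: "y \<notin> ?W" by (rule self_not_exchange_partner[OF X(1) X(4)])
  have zK: "single (single z 1) c \<in> ?K" if "z \<in> ?W" for z and c :: 'k
    using that W by (auto simp: graded_kernel_def specialise_single monomials_def)
  have lead_K: "lead_coeff_in y ` ?G \<subseteq> ?K"
  proof safe
    fix g assume "g \<in> ?G"
    then obtain q q' where g: "g = single q 1 - single q' 1" and q: "q \<in> quadratic_monomials X"
        "q' \<in> quadratic_monomials X" "edge_degree q = edge_degree q'" "q \<noteq> q'"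
      by (auto simp: quadratic_binomials_def)
    have qX: "q \<in> monomials X" "q' \<in> monomials X" using q quadratic_monomials_subset by auto
    show "lead_coeff_in y g \<in> ?K"
    proof (cases rule: exchange_binomial_cases[OF X(1) X(4) q])
      case 1
      have "deg_in y g = 0"
        using 1 q(4) by (intro deg_inI[of q]) (auto simp: g keys_binomial)
      moreover have "keys q \<inter> ?W = {} \<longleftrightarrow> keys q' \<inter> ?W = {}"
        using exchange_partners_saturated[OF X, of q _ q'] exchange_partners_saturated[OF X, of q' _ q]
          qX q(3) 1 by auto
      then have "g \<in> ?K"
        using qX q(3) 1 unfolding g by (intro binomial_in_graded_kernel) (auto simp: bidegree_def)
      ultimately show ?thesis by (simp add: deg_in_0)
    next
      case (2 z)
      then have "z \<noteq> y" using yW by auto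
      then show ?thesis
        using lead_coeff_exchange(2)[of z y q' "1::'k"] 2 zK[of z 1] by (simp add: g)
    next
      case (3 z)
      then have "z \<noteq> y" using yW by auto
      \<comment> \<open>The exchange with both signs reversed.\<close>
      moreover have "g = single (single y 1 + single z 1) (-1) - single q (-1)"
        by (simp add: g 3 single_uminus)
      ultimately show ?thesis
        using lead_coeff_exchange(2)[of z y q "-1::'k"] 3 zK[of z "-1"] by simp
    qed
  qed
  then show "?C \<subseteq> ?K"
    unfolding C_ideal_def by (intro Idl_least ideal_graded_kernel bidegree_add)
  have C: "ideal ?C (poly_ring X)"
    unfolding C_ideal_def using lead_K by (intro ideal_Idl) (auto simp: graded_kernel_def)
  have lead_C: "lead_coeff_in y g \<in> ?C" if "g \<in> ?G" for g
    using that Idl_superset[of "lead_coeff_in y ` ?G" X] unfolding C_ideal_def by blast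
  have varC: "var ` ?W \<subseteq> ?C"
  proof safe
    fix z assume z: "z \<in> ?W"
    then have "z \<noteq> y" using yW by auto
    obtain q where q: "q \<in> quadratic_monomials X" "q \<noteq> single y 1 + single z 1" "lookup q y = 0"
        "edge_degree q = edge_degree (single y 1 + single z 1)"
      using exchange_partnerE[OF X(1) z] .
    have "single y 1 + single z 1 \<in> quadratic_monomials X"
      using z W X(4) unfolding quadratic_monomials_def by blast
    then have "single (single y 1 + single z 1) 1 - single q 1 \<in> ?G"
      using q by (intro quadratic_binomialsI) auto
    from lead_C[OF this] show "(var z :: ('v set, 'k) mpoly) \<in> ?C"
      using lead_coeff_exchange(2)[of z y q "1::'k"] \<open>z \<noteq> y\<close> q(3) by (simp add: var_def)
  qed
  have freeC: "quadratic_binomials (X - {y}) \<subseteq> ?C"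
  proof
    fix g :: "('v set, 'k) mpoly" assume g: "g \<in> quadratic_binomials (X - {y})"
    then obtain q q' where q: "g = single q 1 - single q' 1" "q \<noteq> q'"
        "q \<in> monomials (X - {y})" "q' \<in> monomials (X - {y})"
      using quadratic_monomials_subset unfolding quadratic_binomials_def by blast
    then have "deg_in y g = 0"
      by (intro deg_inI[of q]) (auto simp: keys_binomial monomials_Diff in_keys_iff)
    then show "g \<in> ?C"
      using lead_C[of g] g quadratic_binomials_mono[of "X - {y}" X] deg_in_0(1)[of y g] by auto
  qed
  show "?K \<subseteq> ?C"
  proof (rule graded_kernel_subset_ideal[OF C bidegree_add])
    show "single m 1 \<in> ?C" if "m \<in> monomials X" "keys m \<inter> ?W \<noteq> {}" for m
      using monomial_in_ideal[OF C varC that] .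
    show "single m 1 - single m' 1 \<in> ?C"
      if m: "m \<in> monomials X" "m' \<in> monomials X" "bidegree y m = bidegree y m'" for m m'
    proof -
      let ?j = "lookup m y"
      let ?n = "m - single y ?j" and ?n' = "m' - single y ?j"
      have mn: "m = ?n + single y ?j" "m' = ?n' + single y ?j"
        using m(3) by (auto intro!: mono_split simp: bidegree_def)
      have n: "?n \<in> monomials X" "?n' \<in> monomials X"
        using m(1,2) mn by (metis monomials_add_iff)+
      have "edge_degree ?n + edge_degree (single y ?j) = edge_degree ?n' + edge_degree (single y ?j)"
        using m(3) mn unfolding bidegree_def by (metis edge_degree_add prod.inject)
      then have "single ?n 1 - single ?n' 1 \<in> ?C"
        using n X(2) m(3)
        by (intro binomial_in_ideal[OF C, of "X - {y}"] freeC quadratic_rewriting_subset[OF X(3)])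
          (auto simp: monomials_Diff in_keys_iff lookup_minus bidegree_def)
      then have "single (single y ?j) 1 * (single ?n 1 - single ?n' 1) \<in> ?C"
        using X(4) by (intro ideal_poly_ringD(5)[OF C]) (auto simp: monomials_def)
      also have "single (single y ?j) 1 * (single ?n 1 - single ?n' 1) =
          single (?n + single y ?j) 1 - single (?n' + single y ?j) (1 :: 'k)"
        by (simp add: right_diff_distrib mult_single add.commute)
      finally show ?thesis using mn by simp
    qed
  qed
qed

text \<open>
  Let \<open>m\<^sub>0\<close> be a surviving term of top degree \<open>d\<close> in \<open>y\<close>. By \<open>degree_drop_impossible\<close> every term of \<open>f\<close>
  of the same edge degree also has degree \<open>d\<close> in \<open>y\<close>, and it involves no partner \<open>z\<close>, since
  exchanging \<open>y z\<close> would lower the degree. Hence the terms whose coefficients have to cancel for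
  \<open>in\<^sub>y(f)\<close> are exactly those that cancel for \<open>f\<close>.
\<close>

lemma init_in_in_bidegree_kernel:
  fixes X :: "'v set set" and f :: "('v set, 'k::field) mpoly"
  assumes X: "\<forall>e\<in>X. card e = 2" "finite X" "quadratic_rewriting X" "y \<in> X"
    and f: "f \<in> graded_kernel edge_degree X {}" and deg: "deg_in y f \<noteq> 0"
  shows "init_in y f \<in> graded_kernel (bidegree y) X (exchange_partners X y)"
proof -
  let ?W = "exchange_partners X y" and ?d = "deg_in y f"
  have fX: "f \<in> carrier (poly_ring X)" using f by (simp add: graded_kernel_def)
  then have keysX: "m \<in> monomials X" if "m \<in> keys f" for m using that by (auto simp: carrier_poly_ring)
  have "lookup (specialise (bidegree y) ?W (init_in y f)) (j, c) = 0" for j c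
  proof -
    let ?S = "{m. m \<in> keys (init_in y f) \<and> keys m \<inter> ?W = {} \<and> bidegree y m = (j, c)}"
    have "(\<Sum>m\<in>?S. lookup (init_in y f) m) = 0"
    proof (cases "?S = {}")
      case True
      show ?thesis unfolding True by simp
    next
      case False
      then obtain m0 where m0: "m0 \<in> keys f" "lookup m0 y = ?d" "keys m0 \<inter> ?W = {}"
          "j = ?d" "edge_degree m0 = c"
        by (auto simp: keys_init_in bidegree_def)
      let ?n = "m0 - single y ?d"
      have m0n: "m0 = single y ?d + ?n" using mono_split[OF m0(2)] by (simp add: add.commute)
      have n: "?n \<in> monomials X" "lookup ?n y = 0" "keys ?n \<inter> ?W = {}"
        using keysX[OF m0(1)] m0n m0(2,3)
        by (metis monomials_add_iff, simp add: lookup_minus, metis disjoint_iff in_keys_iff lookup_minus diff_0_eq_0)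
      have no_drop: "\<not> lookup m y < ?d" if "m \<in> monomials X" "edge_degree m = c" for m
        using degree_drop_impossible[OF X n that(1), of ?d] m0(5) m0n that(2) by auto
      have "lookup m y = ?d \<and> keys m \<inter> ?W = {}" if m: "m \<in> keys f" "edge_degree m = c" for m
      proof
        show my: "lookup m y = ?d"
          using no_drop[OF keysX[OF m(1)] m(2)] deg_in_ge[OF m(1), of y] by simp
        show "keys m \<inter> ?W = {}"
        proof (rule ccontr)
          assume "keys m \<inter> ?W \<noteq> {}"
          then obtain z where z: "z \<in> keys m" "z \<in> ?W" by auto
          have "z \<noteq> y" using z(2) self_not_exchange_partner[OF X(1) X(4)] by auto
          obtain p where p: "p \<in> quadratic_monomials X" "lookup p y = 0"
              "edge_degree p = edge_degree (single y 1 + single z 1)"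
            using exchange_partnerE[OF X(1) z(2)] .
          define s where "s = m - single z 1 - single y 1"
          have "y \<in> keys (m - single z 1)"
            using my deg \<open>z \<noteq> y\<close> by (simp add: in_keys_iff lookup_minus lookup_single)
          then have m_eq: "m = s + single y 1 + single z 1"
            unfolding s_def using split_off_variable[OF z(1)] split_off_variable by metis
          have "s \<in> monomials X" using keysX[OF m(1)] m_eq by (metis monomials_add_iff)
          then have "s + p \<in> monomials X" using p(1) quadratic_monomials_subset by auto
          moreover have "edge_degree (s + p) = c"
            using m(2) p(3) arg_cong[OF m_eq, of edge_degree] by (simp add: edge_degree_add ac_simps)
          moreover have "lookup (s + p) y < ?d"
            using my p(2) deg \<open>z \<noteq> y\<close> by (simp add: s_def lookup_add lookup_minus lookup_single)
          ultimately show False using no_drop by blast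
        qed
      qed
      then have "?S = {m. m \<in> keys f \<and> keys m \<inter> {} = {} \<and> edge_degree m = c}"
        using m0(4) by (auto simp: keys_init_in bidegree_def)
      moreover have "(\<Sum>m\<in>?S. lookup (init_in y f) m) = (\<Sum>m\<in>?S. lookup f m)"
        by (rule sum.cong) (auto simp: keys_init_in lookup_init_in)
      ultimately have "(\<Sum>m\<in>?S. lookup (init_in y f) m) = lookup (specialise edge_degree {} f) c"
        unfolding lookup_specialise by simp
      then show ?thesis using f by (simp add: graded_kernel_def)
    qed
    then show ?thesis unfolding lookup_specialise .
  qed
  then have "specialise (bidegree y) ?W (init_in y f) = 0"
    by (intro poly_mapping_eqI) auto
  then show ?thesis using init_in_closed[OF fX] by (simp add: graded_kernel_def)
qed

section \<open>Induction on the number of edges\<close>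

text \<open>
  The variables in \<open>Z\<close> are those already added to the ideal by earlier passages to \<open>C\<close>; allowing them in
  the statement lets the induction run inside one family of prime ideals. If \<open>X = Z\<close> the ideal is generated
  by variables. If \<open>Z\<close> is a nonempty proper subset,
  decomposing at \<open>y \<in> Z\<close> removes \<open>y\<close> from the ring, with \<open>C = \<langle>1\<rangle>\<close>. If \<open>Z\<close> is empty, any edge \<open>y\<close> will do:
  \<open>N\<close> is the ideal of the graph without \<open>y\<close>, and \<open>C\<close> that of the same graph with the exchange
  partners of \<open>y\<close> sent to 0.
\<close>

lemma edge_kernel_geom_vertex_decomposable:
  fixes X Z :: "'v set set"
  assumes "finite X" "Z \<subseteq> X" "\<forall>e\<in>X. card e = 2" "quadratic_rewriting (X - Z)"
  shows "geom_vertex_decomposable X (graded_kernel edge_degree X Z :: ('v set, 'k::field) mpoly set)"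
  using assms
proof (induction "card X" arbitrary: X Z rule: less_induct)
  case less
  note fin = \<open>finite X\<close> and ZX = \<open>Z \<subseteq> X\<close> and X2 = less.prems(3) and rw = \<open>quadratic_rewriting (X - Z)\<close>
  let ?I = "graded_kernel edge_degree X Z :: ('v set, 'k) mpoly set"
  let ?G = "var ` Z \<union> quadratic_binomials (X - Z) :: ('v set, 'k) mpoly set"
  have prime: "primeideal ?I (poly_ring X)" by (rule primeideal_graded_kernel[OF edge_degree_add])
  then have unm: "unmixed (poly_ring X) ?I" by (intro unmixed_if_prime_or_unit) simp
  have I: "ideal ?I (poly_ring X)" by (rule ideal_graded_kernel[OF edge_degree_add])
  show ?case
  proof (cases "X = Z")
    case True
    have "?I = Idl\<^bsub>poly_ring X\<^esub> (var ` X)"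
      using Idl_variables_eq_kernel[OF fin, where 'k = 'k] rw True by simp
    with unm show ?thesis by (intro geom_vertex_decomposable.variables) auto
  next
    case False
    then obtain y where y: "y \<in> X" "Z \<noteq> {} \<longrightarrow> y \<in> Z" using ZX by blast
    obtain ys where ys: "set ys = X - {y}" using finite_list[of "X - {y}"] fin by auto
    then have xs: "set (y # ys) = X" using y by auto
    let ?r = "lex_order (y # ys)"
    have gb: "groebner_basis X ?r ?I ?G" by (rule groebner_basis_edge_kernel[OF xs ZX rw])
    then have GI: "?G \<subseteq> ?I" and 0: "0 \<notin> ?G" by (auto simp: groebner_basis_def)
    have compat: "compatible_order TYPE('k) X y ?r" using xs by (intro compatible_lex_order) auto
    note N = N_ideal_contraction[OF fin ZX rw GI 0, of y]
    let ?N = "N_ideal X y ?G" and ?C = "C_ideal X y ?G"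
    have card: "card (X - {y}) < card X" using y fin by (intro psubset_card_mono) auto
    have "geom_vertex_decomposable (X - {y}) (?N \<inter> carrier (poly_ring (X - {y})))"
      unfolding N(1)
      using quadratic_rewriting_subset[OF rw, of "X - {y} - (Z - {y})"] fin ZX X2
      by (intro less.hyps[OF card]) auto
    moreover have free: "?I \<inter> carrier (poly_ring (X - {y})) \<subseteq> ?N"
      using N(2) unfolding kernel_deletion .
    have "init_ideal_in X y ?I = ?C \<inter> (?N <+>\<^bsub>poly_ring X\<^esub> Idl\<^bsub>poly_ring X\<^esub> {var y}) \<and>
        geom_vertex_decomposable (X - {y}) (?C \<inter> carrier (poly_ring (X - {y})))"
    proof (cases "Z = {}")
      case False
      with y have yZ: "y \<in> Z" by simp
      have lc: "lead_coeff_in y g \<in> carrier (poly_ring X)" if "g \<in> ?G" for g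
        using lead_coeff_in_closed[of g X y] that GI poly_ring_mono[of "X - {y}" X]
        unfolding graded_kernel_def by blast
      then have C: "ideal ?C (poly_ring X)"
        unfolding C_ideal_def by (intro ideal_Idl) auto
      have dy: "deg_in y (var y :: ('v set, 'k) mpoly) = 1"
        by (rule deg_inI[of "single y 1"]) (auto simp: var_def)
      have "lead_coeff_in y (var y :: ('v set, 'k) mpoly) = single 0 1"
      proof (rule poly_mapping_eqI)
        fix m :: "'v set mono"
        have "single y 1 = m + single y 1 \<longleftrightarrow> m = 0" by auto
        then show "lookup (lead_coeff_in y (var y :: ('v set, 'k) mpoly)) m = lookup (single 0 1) m"
          unfolding lead_coeff_in_def dy lookup_coeff_in
          by (auto simp: var_def lookup_single lookup_one when_def)
      qed
      moreover have "lead_coeff_in y (var y :: ('v set, 'k) mpoly) \<in> ?C"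
        using yZ Idl_superset[of "lead_coeff_in y ` ?G" X] unfolding C_ideal_def by blast
      ultimately have "1 \<in> ?C" by simp
      then have "r \<in> ?C" if "r \<in> carrier (poly_ring X)" for r
        using ideal_poly_ringD(5)[OF C _ that, of 1] by simp
      then have C_all: "?C = carrier (poly_ring X)" using ideal_poly_ringD(1)[OF C] by blast
      have deg: "deg_in y g \<le> 1" if "g \<in> ?G" for g
      proof -
        have "lookup m y \<le> 1" if "m \<in> keys g" for m
        proof (cases "g \<in> var ` Z")
          case True
          then show ?thesis using that by (auto simp: var_def lookup_single when_def)
        next
          case False
          with \<open>g \<in> ?G\<close> have "g \<in> quadratic_binomials (X - Z)" by blast
          then obtain q q' where "g = single q 1 - single q' 1" "q \<noteq> q'"
              "q \<in> monomials (X - Z)" "q' \<in> monomials (X - Z)"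
            using quadratic_monomials_subset unfolding quadratic_binomials_def by blast
          with that yZ have "y \<notin> keys m" by (auto simp: keys_binomial monomials_Diff)
          then show ?thesis by (simp add: in_keys_iff)
        qed
        moreover have "g \<noteq> 0" using that 0 by metis
        ultimately show ?thesis using deg_in_attained[of g y] by metis
      qed
      have "init_ideal_in X y ?I = ?C \<inter> (?N <+>\<^bsub>poly_ring X\<^esub> Idl\<^bsub>poly_ring X\<^esub> {var y})"
        using init_in_closed[of _ X y]
        by (intro init_ideal_in_eq I GI y deg free) (auto simp: C_all graded_kernel_def)
      moreover have "?C \<inter> carrier (poly_ring (X - {y})) = carrier (poly_ring (X - {y}))"
        unfolding C_all using poly_ring_mono[of "X - {y}" X] by blast
      then have "geom_vertex_decomposable (X - {y}) (?C \<inter> carrier (poly_ring (X - {y})))"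
        by (intro geom_vertex_decomposable.unit_ideal unmixed_if_prime_or_unit) auto
      ultimately show ?thesis ..
    next
      case True
      let ?W = "exchange_partners X y"
      have rwX: "quadratic_rewriting X" using rw True by simp
      have C_eq: "?C = graded_kernel (bidegree y) X ?W"
        using C_ideal_eq_bidegree_kernel[OF X2 fin rwX y(1), where 'k = 'k] True by simp
      have yW: "y \<notin> ?W" by (rule self_not_exchange_partner[OF X2 y(1)])
      have deg: "deg_in y g \<le> 1" if gG: "g \<in> ?G" for g
      proof -
        obtain q q' where g: "g = single q 1 - single q' 1" and q: "q \<in> quadratic_monomials X"
            "q' \<in> quadratic_monomials X" "edge_degree q = edge_degree q'" "q \<noteq> q'"
          using gG True by (auto simp: quadratic_binomials_def)
        have "lookup q y \<le> 1 \<and> lookup q' y \<le> 1"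
          using yW by (cases rule: exchange_binomial_cases[OF X2 y(1) q])
            (auto simp: lookup_add lookup_single when_def)
        moreover obtain m where "m \<in> keys g" "lookup m y = deg_in y g"
          using deg_in_attained[of g y] gG 0 by metis
        ultimately show ?thesis using q(4) by (auto simp: g keys_binomial)
      qed
      have "init_ideal_in X y ?I = ?C \<inter> (?N <+>\<^bsub>poly_ring X\<^esub> Idl\<^bsub>poly_ring X\<^esub> {var y})"
      proof (rule init_ideal_in_eq[OF I GI y(1) deg _ _ free])
        show "init_in y f \<in> ?C" if "f \<in> ?I" "deg_in y f \<noteq> 0" for f
          unfolding C_eq using that True by (intro init_in_in_bidegree_kernel[OF X2 fin rwX y(1)]) auto
        show "k \<in> ?C" if "k \<in> carrier (poly_ring X)" "k * var y \<in> ?C" for k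
          using bidegree_kernel_cancel[OF yW] that unfolding C_eq by blast
      qed
      moreover have "?C \<inter> carrier (poly_ring (X - {y})) = graded_kernel edge_degree (X - {y}) ?W"
        unfolding C_eq by (rule bidegree_kernel_contraction)
      moreover have "geom_vertex_decomposable (X - {y})
          (graded_kernel edge_degree (X - {y}) ?W :: ('v set, 'k) mpoly set)"
      proof (rule less.hyps[OF card])
        show "?W \<subseteq> X - {y}" using yW by (auto simp: exchange_partners_def)
        show "quadratic_rewriting (X - {y} - ?W)"
          by (rule quadratic_rewriting_subset[OF rwX fin]) auto
      qed (use fin X2 in auto)
      ultimately show ?thesis by simp
    qed
    ultimately show ?thesis
      by (intro geom_vertex_decomposable.decompose[OF I unm y(1) compat gb]) auto
  qed
qed

section \<open>Universal quadratic Groebner bases\<close>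

definition mono_degree :: "'x mono \<Rightarrow> nat" where
  "mono_degree m = (\<Sum>x\<in>keys m. lookup m x)"

lemma mono_degree_add: "mono_degree (m + n) = mono_degree m + mono_degree n"
  unfolding mono_degree_def by (rule sum_keys_add) simp_all

lemma mono_degree_single [simp]: "mono_degree (single x k) = k"
  by (cases "k = 0") (simp_all add: mono_degree_def)

lemma mono_degree_sum: "mono_degree (sum f S) = (\<Sum>i\<in>S. mono_degree (f i))"
  by (induction S rule: infinite_finite_induct) (simp_all add: mono_degree_add, simp_all add: mono_degree_def)

lemma mono_degree_edge_degree:
  assumes "\<forall>e\<in>X. card e = 2" "m \<in> monomials X"
  shows "mono_degree (edge_degree m) = 2 * mono_degree m"
proof -
  have "card e = 2" if "e \<in> keys m" for e using assms that by (auto simp: monomials_def)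
  then show ?thesis
    by (simp add: edge_degree_def mono_degree_sum mono_degree_def[of m] sum_distrib_left)
qed

lemma quadratic_monomialsI:
  assumes "m \<in> monomials X" "mono_degree m = 2"
  shows "m \<in> quadratic_monomials X"
proof -
  have split: "\<exists>a\<in>X. \<exists>r\<in>monomials X. n = r + single a 1 \<and> mono_degree r = d"
    if n: "n \<in> monomials X" "mono_degree n = Suc d" for n d
  proof -
    have "keys n \<noteq> {}" using n(2) by (auto simp: mono_degree_def)
    then obtain a where a: "a \<in> keys n" by (metis ex_in_conv)
    note split = split_off_variable[OF a]
    have "mono_degree n = mono_degree (n - single a 1) + 1"
      by (subst split) (simp only: mono_degree_add mono_degree_single)
    moreover have "n - single a 1 \<in> monomials X" using n(1) split by (metis monomials_add_iff)
    moreover have "a \<in> X" using a n(1) by (auto simp: monomials_def)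
    ultimately show ?thesis using n(2) split by auto
  qed
  obtain a r where a: "a \<in> X" "r \<in> monomials X" "m = r + single a 1" "mono_degree r = 1"
    using split[OF assms(1), of 1] assms(2) by auto
  obtain b t where b: "b \<in> X" "r = t + single b 1" "mono_degree t = 0"
    using split[OF a(2), of 0] a(4) by auto
  have "t = 0" using b(3) by (auto simp: mono_degree_def in_keys_iff simp flip: keys_eq_empty)
  then show ?thesis using a b unfolding quadratic_monomials_def by auto
qed

text \<open>
  The polynomials all of whose monomials are divisible by a leading monomial of \<open>U\<close> form an ideal.
\<close>

lemma in_initial_ideal_divisible:
  fixes U :: "('x, 'k::field) mpoly set"
  assumes U: "U \<subseteq> carrier (poly_ring (set xs))" "0 \<notin> U"
    and m: "single m (1 :: 'k) \<in> Idl\<^bsub>poly_ring (set xs)\<^esub> (initial_term (lex_order xs) ` U)"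
  obtains u s where "u \<in> U" "m = lead_monomial (lex_order xs) u + s"
proof -
  let ?r = "lex_order xs" and ?R = "poly_ring (set xs) :: ('x, 'k) mpoly ring"
  define divisible where "divisible n \<longleftrightarrow> (\<exists>u\<in>U. \<exists>s. n = lead_monomial ?r u + s)" for n
  let ?D = "{p \<in> carrier ?R. \<forall>n\<in>keys p. divisible n}"
  have D: "ideal ?D (poly_ring (set xs))"
  proof (rule ideal_poly_ringI)
    show "p + q \<in> ?D" if "p \<in> ?D" "q \<in> ?D" for p q
      using that keys_add[of p q] poly_ring_closed(1)[of p "set xs" q] by blast
    show "q * p \<in> ?D" if "p \<in> ?D" "q \<in> carrier ?R" for p q
    proof -
      have "divisible n" if n: "n \<in> keys (q * p)" for n
      proof -
        obtain a b where "n = a + b" "b \<in> keys p" using n keys_mult[of q p] by blast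
        moreover from this obtain u s where "u \<in> U" "b = lead_monomial ?r u + s"
          using \<open>p \<in> ?D\<close> unfolding divisible_def by blast
        ultimately have "u \<in> U" "n = lead_monomial ?r u + (s + a)" by (simp_all add: ac_simps)
        then show ?thesis unfolding divisible_def by blast
      qed
      then show ?thesis using that poly_ring_closed(2)[of q "set xs" p] by blast
    qed
  qed (auto simp: carrier_poly_ring[of 0])
  have "initial_term ?r u \<in> ?D" if u: "u \<in> U" for u
  proof -
    have "u \<noteq> 0" "u \<in> carrier ?R" using u U by auto
    then have "lead_monomial ?r u \<in> monomials (set xs)"
      using lead_monomial_lex(1)[of u xs] unfolding carrier_poly_ring by blast
    moreover have "divisible (lead_monomial ?r u)" unfolding divisible_def using u by (metis add.right_neutral)
    ultimately show ?thesis using \<open>u \<noteq> 0\<close> by (auto simp: initial_term_def split: if_splits)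
  qed
  then have "initial_term ?r ` U \<subseteq> ?D" by (rule image_subsetI)
  from subsetD[OF Idl_least[OF D this] m] have "single m 1 \<in> ?D" .
  then show ?thesis using that unfolding divisible_def by auto
qed

text \<open>
  If \<open>m'\<close> is smaller than \<open>m\<close> and of the same degree, \<open>m\<close> is the leading monomial of the element
  \<open>m - m'\<close> of the toric ideal, hence divisible by the leading monomial of some \<open>u \<in> U\<close>. The two terms
  of \<open>u\<close> cancel each other, so they have equal edge degree. As each edge has two endpoints, they have
  equal total degree too, so both are quadratic.
\<close>

lemma universal_quadratic_imp_rewriting:
  fixes E :: "'v set set" and U :: "('v set, 'k::field) mpoly set"
  assumes E: "\<forall>e\<in>E. card e = 2"
    and U: "universal_groebner_basis E (graded_kernel edge_degree E {}) U"
    and quad: "\<forall>u\<in>U. quadratic_binomial u"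
  shows "quadratic_rewriting E"
  unfolding quadratic_rewriting_def
proof (intro allI impI)
  fix xs m m'
  assume xs: "set xs = E" and m: "m \<in> monomials E" "m' \<in> monomials E"
    "edge_degree m = edge_degree m'" "(m', m) \<in> lex_less xs"
  let ?I = "graded_kernel edge_degree E {} :: ('v set, 'k) mpoly set" and ?r = "lex_order xs"
  have gb: "groebner_basis E ?r ?I U"
    using U monomial_order_lex_order[of xs] xs by (auto simp: universal_groebner_basis_def)
  let ?f = "single m 1 - single m' 1 :: ('v set, 'k) mpoly"
  have f: "?f \<in> ?I" using m by (intro binomial_in_graded_kernel) auto
  have ne: "m \<noteq> m'" using m(4) by auto
  have "lead_monomial ?r ?f = m"
    using m(4) f xs ne by (intro lead_monomial_lexI) (auto simp: keys_binomial graded_kernel_def)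
  moreover have "lookup ?f m = 1" using ne by (simp add: lookup_minus lookup_single)
  moreover from this have "?f \<noteq> 0" by auto
  ultimately have "initial_term ?r ?f = single m 1" by (simp add: initial_term_def)
  then have "single m (1 :: 'k) \<in> Idl\<^bsub>poly_ring E\<^esub> (initial_term ?r ` ?I)"
    using f Idl_superset[of "initial_term ?r ` ?I" E] by (metis imageI subsetD)
  then have m_in: "single m (1 :: 'k) \<in> Idl\<^bsub>poly_ring E\<^esub> (initial_term ?r ` U)"
    using gb by (simp add: groebner_basis_def)
  have UE: "U \<subseteq> carrier (poly_ring E)" "0 \<notin> U" "U \<subseteq> ?I"
    using gb by (auto simp: groebner_basis_def graded_kernel_def)
  obtain u s where u: "u \<in> U" "m = lead_monomial ?r u + s"
    by (rule in_initial_ideal_divisible[OF UE(1)[folded xs] UE(2) m_in[folded xs]])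
  let ?q = "lead_monomial ?r u"
  have "u \<noteq> 0" "u \<in> carrier (poly_ring (set xs))" using u(1) UE xs by auto
  note lead = lead_monomial_lex[OF this]
  obtain q' where q': "q' \<in> keys u" "q' \<noteq> ?q" "edge_degree q' = edge_degree ?q"
    using graded_kernel_partner[of u edge_degree E "{}" ?q] lead(1) u(1) UE(3) by auto
  have qE: "?q \<in> monomials E" "q' \<in> monomials E"
    using lead(1) q'(1) subsetD[OF UE(1) u(1)] by (auto simp: carrier_poly_ring)
  have "card (keys u) = 2" and deg2: "total_degree u = 2"
    using quad u(1) by (auto simp: quadratic_binomial_def)
  then have "keys u = {?q, q'}"
    using lead(1) q'(1,2) by (auto simp: card_2_iff)
  then have "total_degree u = max (mono_degree ?q) (mono_degree q')"
    by (simp add: total_degree_def mono_degree_def)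
  moreover have "mono_degree q' = mono_degree ?q"
    using mono_degree_edge_degree[OF E qE(1)] mono_degree_edge_degree[OF E qE(2)] q'(3) by simp
  ultimately have "mono_degree ?q = 2" "mono_degree q' = 2" using deg2 by auto
  then have "?q \<in> quadratic_monomials E" "q' \<in> quadratic_monomials E"
    using qE quadratic_monomialsI by auto
  then show "\<exists>q q' s. q \<in> quadratic_monomials E \<and> q' \<in> quadratic_monomials E \<and> m = q + s \<and>
      edge_degree q = edge_degree q' \<and> (q', q) \<in> lex_less xs"
    using u(2) q' lead(2) by metis
qed

theorem theorem1p5:
  fixes V :: "'v set" and E :: "'v set set"
    and U :: "('v set, 'k::{alg_closed_field, field_char_0}) mpoly set"
  assumes "finite_simple_graph V E"
    and "universal_groebner_basis E (toric_ideal V E) U"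
    and "\<forall>u\<in>U. quadratic_binomial u"
  shows "geom_vertex_decomposable E
           (toric_ideal V E :: ('v set, 'k) mpoly set)"
proof -
  have E: "\<forall>e\<in>E. card e = 2" and "E \<subseteq> Pow V" "finite V"
    using assms(1) by (auto simp: finite_simple_graph_def)
  then have "finite E" by (auto intro: finite_subset)
  moreover have "quadratic_rewriting (E - {})"
    using universal_quadratic_imp_rewriting[OF E] assms(2,3) by (simp add: toric_ideal_eq_graded_kernel)
  ultimately show ?thesis
    unfolding toric_ideal_eq_graded_kernel
    using E by (intro edge_kernel_geom_vertex_decomposable) auto
qed

end
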